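(* For every integer $k\ge 4$ there exist a finitely generated free group $F$ and a faithful transitive action $F\curvearrowright X$ such that $\mathcal T(F\curvearrowright X)=k$.
   Context: All groups act from the right. A group action $G\curvearrowright X$ admits a paradoxical decomposition if there exist positive integers $m,n$, (pairwise) disjoint subsets $P_1,\dots,P_m,Q_1,\dots,Q_n$ of $X$ and subsets $S_1=\{g_1,\dots,g_m\}$, $S_2=\{h_1,\dots,h_n\}$ of $G$ such that $X=\bigcup_{i=1}^m P_ig_i=\bigcup_{j=1}^n Q_jh_j$. The Tarski number $\mathcal T(G\curvearrowright X)$ is the minimal possible value of $m+n$ over all paradoxical decompositions of the action. *)

theory Defs
  imports
    "HOL-Algebra.Generated_Groups"
    "HOL-Library.Disjoint_Sets"
    "HOL-Library.Extended_Nat"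
begin

(* The letter (s, True) stands for s and (s, False) for its inverse. *)

definition reduced_word :: "('g \<times> bool) list \<Rightarrow> bool" where
  "reduced_word w \<longleftrightarrow> successively (\<lambda>(s, b) (t, c). \<not> (s = t \<and> b \<noteq> c)) w"

definition word_value :: "('g, 'm) monoid_scheme \<Rightarrow> ('g \<times> bool) list \<Rightarrow> 'g" where
  "word_value G w =
     foldr (\<lambda>(s, b) y. (if b then s else inv\<^bsub>G\<^esub> s) \<otimes>\<^bsub>G\<^esub> y) w \<one>\<^bsub>G\<^esub>"

definition free_basis :: "('g, 'm) monoid_scheme \<Rightarrow> 'g set \<Rightarrow> bool" where
  "free_basis G S \<longleftrightarrow>
     S \<subseteq> carrier G \<and>
     (\<forall>g\<in>carrier G. \<exists>!w. w \<in> lists (S \<times> UNIV) \<and> reduced_word w \<and> word_value G w = g)"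

definition free_group :: "('g, 'm) monoid_scheme \<Rightarrow> bool" where
  "free_group G \<longleftrightarrow> group G \<and> (\<exists>S. free_basis G S)"

definition finitely_generated_group :: "('g, 'm) monoid_scheme \<Rightarrow> bool" where
  "finitely_generated_group G \<longleftrightarrow>
     group G \<and> (\<exists>S. finite S \<and> S \<subseteq> carrier G \<and> generate G S = carrier G)"

(* HOL-Algebra.Group_Action treats left actions; all actions below are from the right. *)

locale right_action = group G for G :: "('g, 'm) monoid_scheme" (structure) +
  fixes X :: "'x set" and act :: "'x \<Rightarrow> 'g \<Rightarrow> 'x"
  assumes act_closed: "\<lbrakk>x \<in> X; g \<in> carrier G\<rbrakk> \<Longrightarrow> act x g \<in> X"
    and act_one: "x \<in> X \<Longrightarrow> act x \<one> = x"
    and act_mult: "\<lbrakk>x \<in> X; g \<in> carrier G; h \<in> carrier G\<rbrakk> \<Longrightarrow> act x (g \<otimes> h) = act (act x g) h"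

locale faithful_right_action = right_action +
  assumes faithful: "\<lbrakk>g \<in> carrier G; \<And>x. x \<in> X \<Longrightarrow> act x g = x\<rbrakk> \<Longrightarrow> g = \<one>"

locale transitive_right_action = right_action +
  assumes nonempty: "X \<noteq> {}"
    and transitive: "\<lbrakk>x \<in> X; y \<in> X\<rbrakk> \<Longrightarrow> \<exists>g\<in>carrier G. act x g = y"

(* Pieces may be empty and translating elements may repeat; dropping empty pieces and merging
   pieces with a common translating element shows that this does not affect the minimum of m + n. *)

definition paradoxical_decomposition ::
    "('g, 'm) monoid_scheme \<Rightarrow> 'x set \<Rightarrow> ('x \<Rightarrow> 'g \<Rightarrow> 'x) \<Rightarrow> nat \<Rightarrow> nat \<Rightarrow>
     (nat \<Rightarrow> 'x set) \<Rightarrow> (nat \<Rightarrow> 'x set) \<Rightarrow> (nat \<Rightarrow> 'g) \<Rightarrow> (nat \<Rightarrow> 'g) \<Rightarrow> bool" where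
  "paradoxical_decomposition G X act m n P Q g h \<longleftrightarrow>
     m > 0 \<and> n > 0 \<and>
     (\<forall>i<m. P i \<subseteq> X \<and> g i \<in> carrier G) \<and>
     (\<forall>j<n. Q j \<subseteq> X \<and> h j \<in> carrier G) \<and>
     disjoint_family_on P {..<m} \<and> disjoint_family_on Q {..<n} \<and>
     (\<forall>i<m. \<forall>j<n. P i \<inter> Q j = {}) \<and>
     X = (\<Union>i<m. (\<lambda>x. act x (g i)) ` P i) \<and>
     X = (\<Union>j<n. (\<lambda>x. act x (h j)) ` Q j)"

(* If there is no paradoxical decomposition, this is the infimum of the empty set, i.e. infinity. *)

definition tarski_number ::
    "('g, 'm) monoid_scheme \<Rightarrow> 'x set \<Rightarrow> ('x \<Rightarrow> 'g \<Rightarrow> 'x) \<Rightarrow> enat" where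
  "tarski_number G X act =
     Inf {enat (m + n) | m n. \<exists>P Q g h. paradoxical_decomposition G X act m n P Q g h}"

end

theory Submission
  imports Defs "HOL-Library.Countable_Set"
begin

text \<open>
  Let \<open>F\<close> be free on a basis consisting of \<open>s\<close>, \<open>t\<close> and a set \<open>S'\<close> of \<open>k - 3\<close> elements.

  \<^bold>\<open>At least k pieces.\<close> Suppose that every set of at most \<open>k - 3\<close> elements of \<open>F\<close> has a common fixed
  point. A decomposition with translating elements \<open>g\<^sub>1, \<dots>, g\<^sub>m\<close> and \<open>h\<^sub>1, \<dots>, h\<^sub>n\<close> involves
  \<open>m + n - 2\<close> quotients \<open>g\<^sub>i g\<^sub>1\<inverse>\<close> and \<open>h\<^sub>j h\<^sub>1\<inverse>\<close> with \<open>i, j > 1\<close>. If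
  \<open>m + n < k\<close>, these have a common fixed point, and that point would have to lie in some \<open>P\<^sub>i\<close> and in
  some \<open>Q\<^sub>j\<close> (lemma \<open>tarski_number_ge\<close>).

  \<^bold>\<open>At most k pieces.\<close> It is enough to choose, for every point \<open>x\<close>, a point among \<open>x\<close>, \<open>x s\<close> and a
  point among \<open>x\<close>, \<open>x a\<close> with \<open>a \<in> S'\<close>, such that all the chosen points are different: the
  translating elements are then the identity and \<open>s\<inverse>\<close>, respectively the identity and the \<open>k - 3\<close>
  inverses of elements of \<open>S'\<close>, which makes \<open>2 + (k - 2)\<close> pieces (lemma \<open>tarski_number_le\<close>). By Hall's theorem such choices exist if
  finite subgraphs of the orbit graph have few edges.

  \<^bold>\<open>Reconciling the two.\<close> On the cosets of a subgroup generated by a set \<open>T\<close> of at most \<open>k - 3\<close>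
  elements, \<open>T\<close> has a fixed point, and yet a finite subgraph with \<open>V > 0\<close> vertices has at most
  \<open>V + card T - 1\<close> edges, since each cycle is accounted for by a generator of the stabilizer
  (lemma \<open>sparse_orbit_graph\<close>). This is just sufficient for Hall's condition. The disjoint union of
  all these coset spaces therefore has both properties.

  \<^bold>\<open>Transitivity.\<close> The choices above involve the generators \<open>s\<close> and \<open>S'\<close> only, and that \<open>T\<close> has a fixed
  point depends on the values of \<open>t\<close> at finitely many points of the coset space. Outside these finite
  sets \<open>t\<close> may be replaced by any bijection that leaves it a permutation. The orbits of the other generators are infinite, again
  by sparsity, so a suitable bijection connects all of them (lemma \<open>make_transitive\<close>).
\<close>

section \<open>Free reduction of words\<close>

definition opposite :: "'g \<times> bool \<Rightarrow> 'g \<times> bool" where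
  "opposite a = (fst a, \<not> snd a)"

definition cancel_cons :: "'g \<times> bool \<Rightarrow> ('g \<times> bool) list \<Rightarrow> ('g \<times> bool) list" where
  "cancel_cons a w = (if w \<noteq> [] \<and> hd w = opposite a then tl w else a # w)"

abbreviation prepend :: "('g \<times> bool) list \<Rightarrow> ('g \<times> bool) list \<Rightarrow> ('g \<times> bool) list" where
  "prepend u w \<equiv> foldr cancel_cons u w"

lemma opposite_opposite [simp]: "opposite (opposite a) = a"
  by (simp add: opposite_def)

lemma reduced_word_Nil [simp]: "reduced_word []"
  by (simp add: reduced_word_def)

lemma reduced_word_Cons:
  "reduced_word (a # w) \<longleftrightarrow> (w = [] \<or> hd w \<noteq> opposite a) \<and> reduced_word w"
  by (cases a; cases w) (auto simp: reduced_word_def opposite_def)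

lemma reduced_cancel_cons: "reduced_word w \<Longrightarrow> reduced_word (cancel_cons a w)"
  by (cases w) (auto simp: cancel_cons_def reduced_word_Cons)

lemma reduced_prepend: "reduced_word w \<Longrightarrow> reduced_word (prepend u w)"
  by (induction u) (auto intro: reduced_cancel_cons)

lemma cancel_cons_opposite:
  "reduced_word w \<Longrightarrow> cancel_cons (opposite a) (cancel_cons a w) = w"
  by (cases w) (auto simp: cancel_cons_def reduced_word_Cons)

lemma prepend_Nil_reduced: "reduced_word u \<Longrightarrow> prepend u [] = u"
  by (induction u) (auto simp: reduced_word_Cons cancel_cons_def)

lemma prepend_cancel_cons:
  assumes "reduced_word w"
  shows "prepend (cancel_cons a u) w = cancel_cons a (prepend u w)"
proof (cases "u \<noteq> [] \<and> hd u = opposite a")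
  case True
  then obtain v where "u = opposite a # v"
    by (cases u) auto
  then show ?thesis
    using cancel_cons_opposite[OF reduced_prepend[OF assms], of "opposite a" v]
    by (simp add: cancel_cons_def)
qed (auto simp: cancel_cons_def)

text \<open>
  On reduced words, \<open>cancel_cons a\<close> is a permutation with inverse \<open>cancel_cons (opposite a)\<close>.
  Prepending is therefore composition of permutations, which is why it is associative and why the
  free group can be built without any confluence argument.
\<close>

lemma prepend_assoc:
  "reduced_word w \<Longrightarrow> prepend (prepend u v) w = prepend u (prepend v w)"
  by (induction u) (auto simp: prepend_cancel_cons)

lemma prepend_inverse:
  "reduced_word w \<Longrightarrow> prepend (map opposite (rev u)) (prepend u w) = w"
  by (induction u arbitrary: w) (auto simp: cancel_cons_opposite reduced_prepend)

lemma lists_cancel_cons: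
  "a \<in> S \<times> UNIV \<Longrightarrow> w \<in> lists (S \<times> UNIV) \<Longrightarrow> cancel_cons a w \<in> lists (S \<times> UNIV)"
  by (cases w) (auto simp: cancel_cons_def)

lemma lists_prepend:
  "u \<in> lists (S \<times> UNIV) \<Longrightarrow> w \<in> lists (S \<times> UNIV) \<Longrightarrow> prepend u w \<in> lists (S \<times> UNIV)"
proof (induction u)
  case (Cons a u)
  then show ?case
    using lists_cancel_cons[of a S "prepend u w"] by simp
qed simp

lemma lists_opposite_rev:
  "u \<in> lists (S \<times> UNIV) \<Longrightarrow> map opposite (rev u) \<in> lists (S \<times> UNIV)"
  by (auto simp: opposite_def in_lists_conv_set)

text \<open>
  The elements are codes of reduced words, so that the free group consists of natural numbers.
\<close>

definition coded_free_group :: "'a::countable set \<Rightarrow> nat monoid" where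
  "coded_free_group A =
     \<lparr>carrier = to_nat ` {w. w \<in> lists (A \<times> (UNIV :: bool set)) \<and> reduced_word w},
      mult = (\<lambda>x y. to_nat (prepend (from_nat x) (from_nat y :: ('a \<times> bool) list))),
      one = to_nat ([] :: ('a \<times> bool) list)\<rparr>"

lemma group_coded_free_group: "group (coded_free_group A)"
proof (rule groupI)
  fix x assume "x \<in> carrier (coded_free_group A)"
  then obtain u where u: "x = to_nat u" "u \<in> lists (A \<times> UNIV)" "reduced_word u"
    by (auto simp: coded_free_group_def)
  define v where "v = prepend (map opposite (rev u)) []"
  have "v \<in> lists (A \<times> UNIV)" "reduced_word v"
    unfolding v_def using lists_prepend[OF lists_opposite_rev[OF u(2)]] reduced_prepend[OF reduced_word_Nil]
    by auto
  moreover have "prepend v u = []"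
    using prepend_inverse[of "[]" u] u(3)
    by (simp add: v_def prepend_assoc prepend_Nil_reduced)
  ultimately show "\<exists>y\<in>carrier (coded_free_group A).
      y \<otimes>\<^bsub>coded_free_group A\<^esub> x = \<one>\<^bsub>coded_free_group A\<^esub>"
    using u(1) by (auto simp: coded_free_group_def)
next
  fix x y assume "x \<in> carrier (coded_free_group A)" "y \<in> carrier (coded_free_group A)"
  then obtain u v :: "('a \<times> bool) list" where
    u: "x = to_nat u" "u \<in> lists (A \<times> UNIV)" and
    v: "y = to_nat v" "v \<in> lists (A \<times> UNIV)" "reduced_word v"
    by (auto simp: coded_free_group_def)
  have "prepend u v \<in> lists (A \<times> UNIV)" "reduced_word (prepend u v)"
    using lists_prepend[OF u(2) v(2)] reduced_prepend[OF v(3)] by auto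
  then show "x \<otimes>\<^bsub>coded_free_group A\<^esub> y \<in> carrier (coded_free_group A)"
    using u(1) v(1) by (auto simp: coded_free_group_def)
qed (auto simp: coded_free_group_def prepend_assoc prepend_Nil_reduced)

text \<open>
  The value of a word in the letters \<open>e s\<close> is the code of its free reduction. Hence a reduced word is
  determined by its value.
\<close>

lemma free_basis_coded_free_group:
  fixes A :: "'a::countable set"
  defines "e \<equiv> \<lambda>s::'a. to_nat [(s, True)]"
  shows "free_basis (coded_free_group A) (e ` A)"
proof -
  let ?F = "coded_free_group A"
  interpret group ?F by (rule group_coded_free_group)
  have inj: "inj e"
    by (auto simp: inj_def e_def)
  have letter: "to_nat [(s, b)] \<in> carrier ?F" if "s \<in> A" for s and b :: bool
    using that by (auto simp: coded_free_group_def reduced_word_Cons intro!: imageI)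
  have e_inv: "inv\<^bsub>?F\<^esub> (e s) = to_nat [(s, False)]" if "s \<in> A" for s
    using letter[OF that] unfolding e_def
    by (intro inv_equality) (auto simp: coded_free_group_def cancel_cons_def opposite_def)
  define spell where "spell = map (\<lambda>(s::'a, b::bool). (e s, b))"
  have spelled: "word_value ?F (spell w) = to_nat (prepend w [])" if "w \<in> lists (A \<times> UNIV)" for w
    using that
  proof (induction w)
    case Nil
    then show ?case by (simp add: word_value_def spell_def coded_free_group_def)
  next
    case (Cons a w)
    obtain s b where a: "a = (s, b)" "s \<in> A"
      using Cons.hyps by (cases a) auto
    have "(if b then e s else inv\<^bsub>?F\<^esub> (e s)) = to_nat [a]"
      using e_inv a by (auto simp: e_def)
    then have "word_value ?F (spell (a # w)) = to_nat [a] \<otimes>\<^bsub>?F\<^esub> word_value ?F (spell w)"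
      by (simp add: word_value_def spell_def a)
    also have "\<dots> = to_nat (prepend (a # w) [])"
      using Cons.IH by (simp add: coded_free_group_def)
    finally show ?case .
  qed
  have reduced_spell: "reduced_word (spell w) \<longleftrightarrow> reduced_word w" for w
    by (auto simp: reduced_word_def spell_def successively_map case_prod_unfold inj_eq[OF inj])
  have lists_spell: "lists (e ` A \<times> UNIV) = spell ` lists (A \<times> UNIV)"
  proof -
    have "e ` A \<times> UNIV = (\<lambda>(s, b::bool). (e s, b)) ` (A \<times> UNIV)"
      by auto
    then show ?thesis by (simp add: spell_def lists_image)
  qed
  have "\<exists>!w. w \<in> lists (e ` A \<times> UNIV) \<and> reduced_word w \<and> word_value ?F w = g"
    if "g \<in> carrier ?F" for g
  proof -
    obtain u where u: "g = to_nat u" "u \<in> lists (A \<times> UNIV)" "reduced_word u"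
      using \<open>g \<in> carrier ?F\<close> by (auto simp: coded_free_group_def)
    show ?thesis
    proof (rule ex1I[of _ "spell u"])
      show "spell u \<in> lists (e ` A \<times> UNIV) \<and> reduced_word (spell u) \<and> word_value ?F (spell u) = g"
        using u by (simp add: lists_spell reduced_spell spelled prepend_Nil_reduced)
    next
      fix w assume w: "w \<in> lists (e ` A \<times> UNIV) \<and> reduced_word w \<and> word_value ?F w = g"
      then obtain v where v: "w = spell v" "v \<in> lists (A \<times> UNIV)"
        by (auto simp: lists_spell)
      with w u spelled[OF v(2)] have "prepend v [] = u" "reduced_word v"
        by (simp_all add: reduced_spell)
      with v(1) show "w = spell u"
        by (simp add: prepend_Nil_reduced)
    qed
  qed
  moreover have "e ` A \<subseteq> carrier ?F"
    using letter by (auto simp: e_def)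
  ultimately show ?thesis
    by (auto simp: free_basis_def)
qed

lemma free_group_of_rank_exists:
  "\<exists>(F :: nat monoid) S. group F \<and> free_basis F S \<and> finite S \<and> card S = n"
proof -
  have "inj_on (\<lambda>s::nat. to_nat [(s, True)]) {..<n}"
    by (auto simp: inj_on_def)
  then show ?thesis
    using group_coded_free_group free_basis_coded_free_group[of "{..<n}"]
    by (metis card_image card_lessThan finite_imageI finite_lessThan)
qed

section \<open>Actions of a free group given by permutations\<close>

locale free_on = group G for G :: "('g, 'm) monoid_scheme" (structure) +
  fixes S :: "'g set"
  assumes basis: "free_basis G S"
begin

abbreviation wordset :: "('g \<times> bool) list set" where
  "wordset \<equiv> lists (S \<times> UNIV)"

definition reduced_form :: "'g \<Rightarrow> ('g \<times> bool) list" where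
  "reduced_form g = (THE w. w \<in> wordset \<and> reduced_word w \<and> word_value G w = g)"

lemma basis_in_carrier: "s \<in> S \<Longrightarrow> s \<in> carrier G"
  using basis by (auto simp: free_basis_def)

lemma reduced_form:
  assumes "g \<in> carrier G"
  shows "reduced_form g \<in> wordset" "reduced_word (reduced_form g)"
    "word_value G (reduced_form g) = g"
proof -
  have "\<exists>!w. w \<in> wordset \<and> reduced_word w \<and> word_value G w = g"
    using basis assms by (simp add: free_basis_def)
  from theI'[OF this] show "reduced_form g \<in> wordset" "reduced_word (reduced_form g)"
    "word_value G (reduced_form g) = g"
    by (simp_all add: reduced_form_def)
qed

definition letter_value :: "'g \<times> bool \<Rightarrow> 'g" where
  "letter_value a = (if snd a then fst a else inv (fst a))"

lemma letter_value_closed: "a \<in> S \<times> UNIV \<Longrightarrow> letter_value a \<in> carrier G"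
  using basis_in_carrier by (auto simp: letter_value_def)

lemma word_value_Nil [simp]: "word_value G [] = \<one>"
  by (simp add: word_value_def)

lemma word_value_Cons [simp]: "word_value G (a # w) = letter_value a \<otimes> word_value G w"
  by (simp add: word_value_def letter_value_def case_prod_unfold)

lemma word_value_closed: "w \<in> wordset \<Longrightarrow> word_value G w \<in> carrier G"
  by (induction w) (auto intro: letter_value_closed)

lemma word_value_append:
  "u \<in> wordset \<Longrightarrow> v \<in> wordset \<Longrightarrow> word_value G (u @ v) = word_value G u \<otimes> word_value G v"
  by (induction u) (auto simp: m_assoc letter_value_closed word_value_closed)

lemma letter_value_opposite:
  "a \<in> S \<times> UNIV \<Longrightarrow> letter_value a \<otimes> letter_value (opposite a) = \<one>"
  using basis_in_carrier by (auto simp: letter_value_def opposite_def)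

lemma word_value_cancel_cons:
  assumes "a \<in> S \<times> UNIV" "w \<in> wordset"
  shows "word_value G (cancel_cons a w) = letter_value a \<otimes> word_value G w"
proof (cases "w \<noteq> [] \<and> hd w = opposite a")
  case True
  then obtain v where v: "w = opposite a # v" by (cases w) auto
  have "opposite a \<in> S \<times> UNIV" using assms(1) by (auto simp: opposite_def)
  moreover have "v \<in> wordset" using assms(2) v by auto
  ultimately have "letter_value a \<otimes> word_value G w
      = (letter_value a \<otimes> letter_value (opposite a)) \<otimes> word_value G v"
    using v assms(1) by (simp add: m_assoc letter_value_closed word_value_closed)
  then show ?thesis
    using v assms(1) \<open>v \<in> wordset\<close>
    by (simp add: letter_value_opposite cancel_cons_def word_value_closed)
qed (auto simp: cancel_cons_def)

lemma word_value_reduce: "w \<in> wordset \<Longrightarrow> word_value G (prepend w []) = word_value G w"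
proof (induction w)
  case (Cons a w)
  moreover from Cons have "prepend w [] \<in> wordset"
    by (intro lists_prepend) auto
  ultimately show ?case by (simp add: word_value_cancel_cons)
qed simp

lemma reduced_form_word_value:
  assumes "w \<in> wordset"
  shows "reduced_form (word_value G w) = prepend w []"
proof -
  have "\<exists>!u. u \<in> wordset \<and> reduced_word u \<and> word_value G u = word_value G w"
    using basis word_value_closed[OF assms] by (simp add: free_basis_def)
  moreover have "prepend w [] \<in> wordset" "reduced_word (prepend w [])"
    using assms lists_prepend[of w S "[]"] reduced_prepend[OF reduced_word_Nil] by auto
  ultimately show ?thesis
    unfolding reduced_form_def using assms word_value_reduce by (intro the1_equality) auto
qed

lemma ex_word: "g \<in> carrier G \<Longrightarrow> \<exists>w\<in>wordset. word_value G w = g"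
  using reduced_form by blast

lemma generate_basis: "generate G S = carrier G"
proof
  show "generate G S \<subseteq> carrier G"
    using basis_in_carrier by (intro generate_incl) auto
  have "word_value G w \<in> generate G S" if "w \<in> wordset" for w
    using that
  proof (induction w)
    case (Cons a w)
    then have "letter_value a \<in> generate G S"
      by (auto simp: letter_value_def intro: generate.incl generate.inv)
    with Cons show ?case by (auto intro: generate.eng)
  qed (auto intro: generate.one)
  then show "carrier G \<subseteq> generate G S"
    using ex_word by blast
qed

definition permutation_family :: "'x set \<Rightarrow> ('g \<Rightarrow> bool \<Rightarrow> 'x \<Rightarrow> 'x) \<Rightarrow> bool" where
  "permutation_family X \<sigma> \<longleftrightarrow>
     (\<forall>s\<in>S. \<forall>b. \<forall>x\<in>X. \<sigma> s b x \<in> X \<and> \<sigma> s (\<not> b) (\<sigma> s b x) = x)"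

definition walk :: "('g \<Rightarrow> bool \<Rightarrow> 'x \<Rightarrow> 'x) \<Rightarrow> 'x \<Rightarrow> ('g \<times> bool) list \<Rightarrow> 'x" where
  "walk \<sigma> x w = foldl (\<lambda>x a. \<sigma> (fst a) (snd a) x) x w"

definition induced_action :: "('g \<Rightarrow> bool \<Rightarrow> 'x \<Rightarrow> 'x) \<Rightarrow> 'x \<Rightarrow> 'g \<Rightarrow> 'x" where
  "induced_action \<sigma> x g = walk \<sigma> x (reduced_form g)"

lemma walk_closed:
  "permutation_family X \<sigma> \<Longrightarrow> w \<in> wordset \<Longrightarrow> x \<in> X \<Longrightarrow> walk \<sigma> x w \<in> X"
  by (induction w arbitrary: x) (auto simp: walk_def permutation_family_def)

lemma walk_reduce:
  assumes "permutation_family X \<sigma>" "w \<in> wordset" "x \<in> X"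
  shows "walk \<sigma> x (prepend w []) = walk \<sigma> x w"
  using assms(2,3)
proof (induction w arbitrary: x)
  case (Cons a w)
  let ?y = "\<sigma> (fst a) (snd a) x"
  let ?u = "prepend w []"
  have "?y \<in> X"
    using assms(1) Cons.hyps(1) Cons.prems by (auto simp: permutation_family_def)
  moreover have "walk \<sigma> x (cancel_cons a ?u) = walk \<sigma> ?y ?u"
  proof (cases "?u \<noteq> [] \<and> hd ?u = opposite a")
    case True
    then obtain v where v: "?u = opposite a # v" by (cases ?u) auto
    have "\<sigma> (fst a) (\<not> snd a) ?y = x"
      using assms(1) Cons.hyps(1) Cons.prems by (auto simp: permutation_family_def)
    then show ?thesis by (simp add: v cancel_cons_def walk_def opposite_def)
  qed (auto simp: cancel_cons_def walk_def)
  ultimately show ?case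
    using Cons.IH[of ?y] by (simp add: walk_def)
qed (simp add: walk_def)

lemma induced_action_word_value:
  assumes "permutation_family X \<sigma>" "w \<in> wordset" "x \<in> X"
  shows "induced_action \<sigma> x (word_value G w) = walk \<sigma> x w"
  using assms by (simp add: induced_action_def reduced_form_word_value walk_reduce)

text \<open>
  The universal property of the free group: permutations for the basis elements, chosen at will,
  extend to an action, because walks do not notice cancellation.
\<close>

lemma right_action_induced_action:
  assumes "permutation_family X \<sigma>"
  shows "right_action G X (induced_action \<sigma>)"
proof
  show "induced_action \<sigma> x g \<in> X" if "x \<in> X" "g \<in> carrier G" for x g
    using that assms by (auto simp: induced_action_def intro!: walk_closed reduced_form)
  show "induced_action \<sigma> x \<one> = x" if "x \<in> X" for x
    using that induced_action_word_value[OF assms, of "[]" x] by (simp add: walk_def)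
  show "induced_action \<sigma> x (g \<otimes> h) = induced_action \<sigma> (induced_action \<sigma> x g) h"
    if "x \<in> X" "g \<in> carrier G" "h \<in> carrier G" for x g h
  proof -
    obtain u v where u: "u \<in> wordset" "g = word_value G u" and v: "v \<in> wordset" "h = word_value G v"
      using \<open>g \<in> carrier G\<close> \<open>h \<in> carrier G\<close> ex_word by metis
    have "walk \<sigma> x u \<in> X"
      using assms u \<open>x \<in> X\<close> by (intro walk_closed)
    moreover have "walk \<sigma> x (u @ v) = walk \<sigma> (walk \<sigma> x u) v"
      by (simp add: walk_def)
    ultimately show ?thesis
      using u v \<open>x \<in> X\<close> assms
      by (simp add: induced_action_word_value word_value_append[symmetric])
  qed
qed

lemma induced_action_letter:
  assumes "permutation_family X \<sigma>" "s \<in> S" "x \<in> X"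
  shows "induced_action \<sigma> x s = \<sigma> s True x" "induced_action \<sigma> x (inv s) = \<sigma> s False x"
  using induced_action_word_value[OF assms(1), of "[(s, True)]" x]
    induced_action_word_value[OF assms(1), of "[(s, False)]" x] assms basis_in_carrier
  by (simp_all add: walk_def letter_value_def)

end

section \<open>Systems of distinct representatives\<close>

definition hall_condition :: "'i set \<Rightarrow> ('i \<times> 'b) set \<Rightarrow> bool" where
  "hall_condition I R \<longleftrightarrow> (\<forall>J. finite J \<and> J \<subseteq> I \<longrightarrow> card J \<le> card (R `` J))"

lemma hall_conditionD:
  "hall_condition I R \<Longrightarrow> finite J \<Longrightarrow> J \<subseteq> I \<Longrightarrow> card J \<le> card (R `` J)"
  by (simp add: hall_condition_def)

text \<open>
  Two different candidates of an index in a minimal relation would give, by minimality, two sets of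
  indices whose candidates become too few when one or the other is deleted. Submodularity of the
  number of candidates then contradicts the condition for the union of the two sets.
\<close>

lemma hall_condition_minimal_unique:
  assumes fin: "\<And>i. i \<in> I \<Longrightarrow> finite (R `` {i})"
    and hall: "hall_condition I R"
    and minimal: "\<And>p. p \<in> R \<Longrightarrow> fst p \<in> I \<Longrightarrow> \<not> hall_condition I (R - {p})"
    and i: "i \<in> I" "(i, x) \<in> R" "(i, y) \<in> R"
  shows "x = y"
proof (rule ccontr)
  assume "x \<noteq> y"
  note hallD = hall_conditionD[OF hall]
  (* Deleting (i, z) can only violate the condition on a set K that contains i; take J = K - {i}. *)
  have tight: "\<exists>J. finite J \<and> J \<subseteq> I \<and> i \<notin> J \<and> card (R `` J \<union> (R `` {i} - {z})) \<le> card J"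
    if "(i, z) \<in> R" for z
  proof -
    obtain K where K: "finite K" "K \<subseteq> I" "card ((R - {(i, z)}) `` K) < card K"
      using minimal[of "(i, z)"] \<open>(i, z) \<in> R\<close> i(1) by (auto simp: hall_condition_def not_le)
    have "i \<in> K"
    proof (rule ccontr)
      assume "i \<notin> K"
      then have "(R - {(i, z)}) `` K = R `` K" by auto
      with K hallD[OF K(1,2)] show False by simp
    qed
    have "(R - {(i, z)}) `` K = R `` (K - {i}) \<union> (R `` {i} - {z})"
      using \<open>i \<in> K\<close> by auto
    then have "card (R `` (K - {i}) \<union> (R `` {i} - {z})) \<le> card (K - {i})"
      using K \<open>i \<in> K\<close> by simp
    with K show ?thesis by (intro exI[of _ "K - {i}"]) auto
  qed
  obtain J where J: "finite J" "J \<subseteq> I" "i \<notin> J" "card (R `` J \<union> (R `` {i} - {x})) \<le> card J"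
    using tight[OF i(2)] by blast
  obtain K where K: "finite K" "K \<subseteq> I" "i \<notin> K" "card (R `` K \<union> (R `` {i} - {y})) \<le> card K"
    using tight[OF i(3)] by blast
  define A B where "A = R `` J \<union> (R `` {i} - {x})" and "B = R `` K \<union> (R `` {i} - {y})"
  have fin_image: "finite (R `` L)" if "finite L" "L \<subseteq> I" for L
  proof -
    have "finite (\<Union>j\<in>L. R `` {j})" using that fin by blast
    also have "(\<Union>j\<in>L. R `` {j}) = R `` L" by auto
    finally show ?thesis .
  qed
  have "finite A" "finite B"
    using fin_image J K i(1) by (auto simp: A_def B_def)
  have "card (insert i (J \<union> K)) \<le> card (R `` insert i (J \<union> K))"
    using J K i(1) by (intro hallD) auto
  moreover have "R `` insert i (J \<union> K) = A \<union> B"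
    using \<open>x \<noteq> y\<close> i by (auto simp: A_def B_def)
  ultimately have union: "card (J \<union> K) + 1 \<le> card (A \<union> B)"
    using J K by simp
  have "card (J \<inter> K) \<le> card (R `` (J \<inter> K))"
    using J K by (intro hallD) auto
  also have "\<dots> \<le> card (A \<inter> B)"
    using \<open>finite A\<close> by (intro card_mono) (auto simp: A_def B_def)
  finally have "card (J \<union> K) + card (J \<inter> K) + 1 \<le> card (A \<union> B) + card (A \<inter> B)"
    using union by simp
  also have "\<dots> = card A + card B"
    using card_Un_Int[OF \<open>finite A\<close> \<open>finite B\<close>] by simp
  also have "\<dots> \<le> card J + card K"
    using J K by (simp add: A_def B_def)
  finally show False
    using card_Un_Int[OF J(1) K(1)] by simp
qed

text \<open>
  Rado's proof of Hall's theorem: Zorn's lemma gives a minimal subrelation that satisfies Hall's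
  condition, because a finite set of indices has finitely many candidates in all and so sees only
  one member of a chain. Finite and infinite index sets are treated alike.
\<close>

theorem distinct_representatives:
  assumes fin: "\<And>i. i \<in> I \<Longrightarrow> finite (R `` {i})" and hall: "hall_condition I R"
  shows "\<exists>f. inj_on f I \<and> (\<forall>i\<in>I. (i, f i) \<in> R)"
proof -
  have fin_image: "finite (R \<inter> J \<times> UNIV)" if "finite J" "J \<subseteq> I" for J
  proof -
    have "finite (SIGMA j:J. R `` {j})" using that fin by blast
    also have "(SIGMA j:J. R `` {j}) = R \<inter> J \<times> UNIV" by auto
    finally show ?thesis .
  qed
  let ?\<A> = "{D. D \<subseteq> R \<and> hall_condition I (R - D)}"
  have "\<exists>D\<in>?\<A>. \<forall>D'\<in>?\<A>. D \<subseteq> D' \<longrightarrow> D' = D"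
  proof (rule subset_Zorn_nonempty)
    show "?\<A> \<noteq> {}" using hall by (auto intro!: exI[of _ "{}"])
  next
    fix \<C> assume ne: "\<C> \<noteq> {}" and chain: "subset.chain ?\<A> \<C>"
    have sub: "\<C> \<subseteq> ?\<A>" using chain by (auto simp: subset.chain_def)
    have "card J \<le> card ((R - \<Union>\<C>) `` J)" if J: "finite J" "J \<subseteq> I" for J
    proof -
      have "finite (\<Union>\<C> \<inter> J \<times> UNIV)"
      proof (rule finite_subset[OF _ fin_image[OF J]])
        show "\<Union>\<C> \<inter> J \<times> UNIV \<subseteq> R \<inter> J \<times> UNIV" using sub by auto
      qed
      then obtain D where D: "D \<in> \<C>" "\<Union>\<C> \<inter> J \<times> UNIV \<subseteq> D"
        using finite_subset_Union_chain[OF _ _ ne chain, of "\<Union>\<C> \<inter> J \<times> UNIV"] by blast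
      then have "(R - \<Union>\<C>) `` J = (R - D) `` J" by blast
      with D sub J show ?thesis by (auto simp: hall_condition_def)
    qed
    then have "hall_condition I (R - \<Union>\<C>)" unfolding hall_condition_def by blast
    moreover have "\<Union>\<C> \<subseteq> R" using sub by blast
    ultimately show "\<Union>\<C> \<in> ?\<A>" by simp
  qed
  then obtain D where "D \<in> ?\<A>" and maximal: "\<forall>D'\<in>?\<A>. D \<subseteq> D' \<longrightarrow> D' = D"
    by (rule bexE)
  then have D: "D \<subseteq> R" "hall_condition I (R - D)" by simp_all
  define M where "M = R - D"
  have hallM: "hall_condition I M" using D by (simp add: M_def)
  have unique: "x = y" if "i \<in> I" "(i, x) \<in> M" "(i, y) \<in> M" for i x y
  proof (rule hall_condition_minimal_unique[of I M, OF _ hallM _ that])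
    show "finite (M `` {i})" if "i \<in> I" for i
      using finite_subset[OF _ fin[OF that], of "M `` {i}"] by (auto simp: M_def)
    show "\<not> hall_condition I (M - {p})" if "p \<in> M" "fst p \<in> I" for p
    proof
      assume "hall_condition I (M - {p})"
      moreover have "M - {p} = R - insert p D" by (auto simp: M_def)
      moreover have "insert p D \<subseteq> R" using D \<open>p \<in> M\<close> by (auto simp: M_def)
      ultimately have "insert p D \<in> ?\<A>" by simp
      with maximal have "insert p D = D" by blast
      with \<open>p \<in> M\<close> show False by (auto simp: M_def)
    qed
  qed
  have "\<exists>x. (i, x) \<in> M" if "i \<in> I" for i
  proof -
    have "card {i} \<le> card (M `` {i})"
      using that by (intro hall_conditionD[OF hallM]) auto
    then have "M `` {i} \<noteq> {}" by (intro notI) simp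
    then show ?thesis by auto
  qed
  then obtain f where f: "\<And>i. i \<in> I \<Longrightarrow> (i, f i) \<in> M" by metis
  have "inj_on f I"
  proof (rule inj_onI, rule ccontr)
    fix i j assume ij: "i \<in> I" "j \<in> I" "f i = f j" "i \<noteq> j"
    have "card {i, j} \<le> card (M `` {i, j})"
      using ij by (intro hall_conditionD[OF hallM]) auto
    moreover have "M `` {i, j} \<subseteq> {f i}"
    proof
      fix y assume "y \<in> M `` {i, j}"
      then have "(i, y) \<in> M \<or> (j, y) \<in> M" by blast
      then have "y = f i \<or> y = f j"
        using unique[OF ij(1) _ f[OF ij(1)]] unique[OF ij(2) _ f[OF ij(2)]] by metis
      then show "y \<in> {f i}" using ij(3) by simp
    qed
    ultimately show False
      using ij(4) card_mono[of "{f i}" "M `` {i, j}"] by simp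
  qed
  with f show ?thesis by (auto simp: M_def)
qed

section \<open>Orbits with few generators in the stabilizer\<close>

context free_on
begin

text \<open>
  A set of edges is the same as a cochain with values in the field with two elements. Letting each
  edge in the set flip a sign gives an action on the double cover of the point set, and the sign
  picked up along a group element is a cocycle.
\<close>

lemma edge_cocycle:
  fixes X :: "'x set"
  assumes "right_action G X act"
  shows "\<exists>c. (\<forall>x\<in>X. \<forall>s\<in>S. c x s \<longleftrightarrow> (x, s) \<in> D) \<and>
     (\<forall>x\<in>X. \<forall>g\<in>carrier G. \<forall>h\<in>carrier G. c x (g \<otimes> h) \<longleftrightarrow> c x g \<noteq> c (act x g) h)"
proof -
  interpret act: right_action G X act by fact
  (* The letter (s, False) traverses the edge labelled s backwards, and that edge starts at the point
     to which the letter leads. *)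
  define sign where "sign x a \<longleftrightarrow> ((if snd a then x else act x (letter_value a)), fst a) \<in> D"
    for x and a :: "'g \<times> bool"
  define \<sigma> where "\<sigma> s b z = (act (fst z) (letter_value (s, b)), snd z \<noteq> sign (fst z) (s, b))"
    for s b and z :: "'x \<times> bool"
  have family: "permutation_family (X \<times> UNIV) \<sigma>"
    using basis_in_carrier
    by (auto simp: permutation_family_def \<sigma>_def sign_def letter_value_def act.act_closed
        act.act_one act.act_mult[symmetric])
  interpret cover: right_action G "X \<times> UNIV" "induced_action \<sigma>"
    using family by (rule right_action_induced_action)
  have walk: "walk \<sigma> (x, e) w = (act x (word_value G w), e \<noteq> snd (walk \<sigma> (x, False) w))"
    if "w \<in> wordset" "x \<in> X" for x e w
    using that
  proof (induction w arbitrary: x e)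
    case (Cons a w)
    let ?y = "act x (letter_value a)"
    have "letter_value a \<in> carrier G"
      using Cons.hyps by (intro letter_value_closed)
    then have "?y \<in> X" "act ?y (word_value G w) = act x (letter_value a \<otimes> word_value G w)"
      using Cons.hyps Cons.prems by (auto simp: act.act_closed act.act_mult word_value_closed)
    moreover have "walk \<sigma> (x, e) (a # w) = walk \<sigma> (?y, e \<noteq> sign x a) w" for e
      by (simp add: walk_def \<sigma>_def)
    ultimately show ?case
      using Cons.IH[of ?y "e \<noteq> sign x a"] Cons.IH[of ?y "sign x a"] by auto
  qed (simp add: walk_def act.act_one)
  define c where "c x g = snd (induced_action \<sigma> (x, False) g)" for x g
  have action: "induced_action \<sigma> (x, e) g = (act x g, e \<noteq> c x g)"
    if "x \<in> X" "g \<in> carrier G" for x e g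
    using walk[of "reduced_form g" x e] that reduced_form by (simp add: c_def induced_action_def)
  have "c x s \<longleftrightarrow> (x, s) \<in> D" if "x \<in> X" "s \<in> S" for x s
    using induced_action_letter[OF family, of s "(x, False)"] that
    by (simp add: c_def \<sigma>_def sign_def)
  moreover have "c x (g \<otimes> h) \<longleftrightarrow> c x g \<noteq> c (act x g) h"
    if "x \<in> X" "g \<in> carrier G" "h \<in> carrier G" for x g h
    using cover.act_mult[of "(x, False)" g h] that
    by (simp add: action act.act_closed)
  ultimately show ?thesis by blast
qed

text \<open>
  A finite subgraph of the orbit graph has Euler characteristic at least one minus the number of
  generators of the stabilizer. Instead of folding graphs and computing ranks of subgroups, count
  sets of edges: such a set is determined by its cocycle on the generators of the stabilizer
  together with a potential on the vertices, and the potential may be normalized at one vertex.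
\<close>

lemma sparse_orbit_graph:
  assumes "transitive_right_action G X act" and v: "v \<in> X"
    and T: "finite T" "T \<subseteq> carrier G"
    and stabilizer: "\<And>g. g \<in> carrier G \<Longrightarrow> act v g = v \<longleftrightarrow> g \<in> generate G T"
    and V: "finite V" "V \<subseteq> X" "V \<noteq> {}"
    and E: "E \<subseteq> V \<times> S" "\<And>x s. (x, s) \<in> E \<Longrightarrow> act x s \<in> V"
  shows "card E + 1 \<le> card V + card T"
proof (cases "finite E")
  case False
  then show ?thesis using V by (simp add: Suc_le_eq card_gt_0_iff)
next
  case True
  interpret transitive_right_action G X act by fact
  have "\<forall>D. \<exists>c. (\<forall>x\<in>X. \<forall>s\<in>S. c x s \<longleftrightarrow> (x, s) \<in> D) \<and>
     (\<forall>x\<in>X. \<forall>g\<in>carrier G. \<forall>h\<in>carrier G. c x (g \<otimes> h) \<longleftrightarrow> c x g \<noteq> c (act x g) h)"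
    using edge_cocycle[OF right_action_axioms] by blast
  then obtain c where
    edge: "\<And>D x s. x \<in> X \<Longrightarrow> s \<in> S \<Longrightarrow> c D x s \<longleftrightarrow> (x, s) \<in> D" and
    cocycle: "\<And>D x g h. x \<in> X \<Longrightarrow> g \<in> carrier G \<Longrightarrow> h \<in> carrier G \<Longrightarrow>
      c D x (g \<otimes> h) \<longleftrightarrow> c D x g \<noteq> c D (act x g) h"
    by metis
  have one: "\<not> c D x \<one>" if "x \<in> X" for D x
    using cocycle[OF that, of \<one> \<one> D] that by (simp add: act_one)
  have inverse: "c D (act x g) (inv g) \<longleftrightarrow> c D x g" if "x \<in> X" "g \<in> carrier G" for D x g
    using cocycle[OF that(1), of g "inv g" D] one[OF that(1), of D] that by simp
  obtain p where p: "\<And>x. x \<in> X \<Longrightarrow> p x \<in> carrier G" "\<And>x. x \<in> X \<Longrightarrow> act v (p x) = x"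
    using transitive[OF v] by metis
  obtain w where w: "w \<in> V" using V by blast
  (* The path to x chosen by p carries a sign. The second component is this potential on V, shifted
     to vanish at w, which leaves only 2 ^ (card V - 1) possibilities. *)
  define code where
    "code D = ({h\<in>T. c D v h}, {x\<in>V. c D v (p x) \<noteq> c D v (p w)})" for D
  have stab: "act v h = v" "h \<in> carrier G" if "h \<in> generate G T" for h
    using that stabilizer generate_in_carrier T by blast+
  (* Each edge closes a loop at v, and the sign of the edge is read off from that of the loop and from
     the potentials of its ends. *)
  define loop where "loop x s = p x \<otimes> s \<otimes> inv (p (act x s))" for x s
  have loop: "loop x s \<in> generate G T"
    and edge_loop: "(x, s) \<in> D \<longleftrightarrow> c D v (loop x s) \<noteq> (c D v (p x) \<noteq> c D v (p (act x s)))"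
    if "x \<in> X" "s \<in> S" for D x s
  proof -
    let ?y = "act x s"
    have s: "s \<in> carrier G" using that basis_in_carrier by simp
    have y: "?y \<in> X" using that s by (simp add: act_closed)
    have to_y: "act v (p x \<otimes> s) = ?y" using that s v p by (simp add: act_mult)
    have return: "act ?y (inv (p ?y)) = v"
      using act_mult[of v "p ?y" "inv (p ?y)"] y p v by (simp add: act_one)
    have "act v (loop x s) = v"
      using that s v p y to_y return by (simp add: loop_def act_mult)
    then show "loop x s \<in> generate G T"
      using that s y p by (simp add: stabilizer[symmetric] loop_def)
    have "c D v (loop x s) \<longleftrightarrow> (c D v (p x) \<noteq> c D x s) \<noteq> c D ?y (inv (p ?y))"
      using that s v p y to_y by (simp add: loop_def cocycle)
    then show "(x, s) \<in> D \<longleftrightarrow> c D v (loop x s) \<noteq> (c D v (p x) \<noteq> c D v (p ?y))"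
      using edge[OF that, of D] inverse[OF v, of "p ?y" D] y p by auto
  qed
  have "inj_on code (Pow E)"
  proof (rule inj_onI)
    fix D D' assume D: "D \<in> Pow E" "D' \<in> Pow E" "code D = code D'"
    have same_on_T: "{h\<in>T. c D v h} = {h\<in>T. c D' v h}"
      using D(3) by (simp add: code_def)
    have generated: "c D v h \<longleftrightarrow> c D' v h" if "h \<in> generate G T" for h
      using that
    proof (induction h rule: generate.induct)
      case one
      then show ?case using \<open>\<And>x D. x \<in> X \<Longrightarrow> \<not> c D x \<one>\<close> v by blast
    next
      case (incl h)
      then show ?case using same_on_T by blast
    next
      case (inv h)
      then have "c D v h \<longleftrightarrow> c D' v h" using same_on_T by blast
      then show ?case
        using inverse[OF v, of h] stab[OF generate.incl[OF inv]] by simp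
    next
      case (eng g h)
      then show ?case using cocycle[OF v] stab by metis
    qed
    have potential: "c D v (p x) \<noteq> c D v (p w) \<longleftrightarrow> c D' v (p x) \<noteq> c D' v (p w)" if "x \<in> V" for x
    proof -
      have "{x\<in>V. c D v (p x) \<noteq> c D v (p w)} = {x\<in>V. c D' v (p x) \<noteq> c D' v (p w)}"
        using D(3) by (simp add: code_def)
      with that show ?thesis by blast
    qed
    have "(x, s) \<in> D \<longleftrightarrow> (x, s) \<in> D'" if xs: "(x, s) \<in> E" for x s
    proof -
      have "x \<in> V" "act x s \<in> V" "x \<in> X" "s \<in> S" using E V xs by auto
      then show ?thesis
        using generated[OF loop, of x s] potential[of x] potential[of "act x s"]
        unfolding edge_loop[OF \<open>x \<in> X\<close> \<open>s \<in> S\<close>] by blast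
    qed
    with D show "D = D'" by auto
  qed
  moreover have "code ` Pow E \<subseteq> Pow T \<times> Pow (V - {w})"
    by (auto simp: code_def)
  ultimately have "card (Pow E) \<le> card (Pow T \<times> Pow (V - {w}))"
    using T V by (intro card_inj_on_le) auto
  then have "(2::nat) ^ card E \<le> 2 ^ (card T + (card V - 1))"
    using True T V w by (simp add: card_Pow card_cartesian_product power_add)
  then have "card E \<le> card T + (card V - 1)"
    by simp
  moreover have "card V \<ge> 1"
    using V by (simp add: Suc_le_eq card_gt_0_iff)
  ultimately show ?thesis by simp
qed

text \<open>
  A finite invariant set would have more edges than sparsity allows.
\<close>

lemma infinite_invariant_subset:
  assumes "transitive_right_action G X act" "v \<in> X" "finite T" "T \<subseteq> carrier G"
    and "\<And>g. g \<in> carrier G \<Longrightarrow> act v g = v \<longleftrightarrow> g \<in> generate G T"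
    and S': "S' \<subseteq> S" "card T < card S'"
    and Y: "Y \<subseteq> X" "Y \<noteq> {}" "\<And>x s. x \<in> Y \<Longrightarrow> s \<in> S' \<Longrightarrow> act x s \<in> Y"
  shows "infinite Y"
proof
  assume "finite Y"
  have "card (Y \<times> S') + 1 \<le> card Y + card T"
    using S' Y \<open>finite Y\<close> by (intro sparse_orbit_graph[OF assms(1-5)]) auto
  moreover obtain n where n: "card Y = Suc n"
    using Y \<open>finite Y\<close> by (cases "card Y") auto
  moreover have "card S' = Suc (card S' - 1)" using S' by simp
  ultimately show False
    using S' by (cases "card S'") (auto simp: card_cartesian_product)
qed

text \<open>
  Hall's condition is a count of edges. If both kinds of demands occur, on a set \<open>A\<close> and on a set
  \<open>B\<close> of points, then the edges labelled by \<open>s\<close> at \<open>A\<close> and those labelled by \<open>S'\<close> at \<open>B\<close> span a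
  graph that by sparsity has at least
  \<open>card A + card B * card S' + 1 - card T \<ge> card A + card B\<close> vertices. If only one kind occurs, each
  point can serve itself.
\<close>

lemma two_disjoint_injections:
  assumes "transitive_right_action G X act" "v \<in> X" "finite T" "T \<subseteq> carrier G"
    and "\<And>g. g \<in> carrier G \<Longrightarrow> act v g = v \<longleftrightarrow> g \<in> generate G T"
    and S': "s \<in> S" "S' \<subseteq> S" "finite S'" "s \<notin> S'" "S' \<noteq> {}" "card T \<le> card S'"
  shows "\<exists>f. inj_on f (X \<times> UNIV) \<and>
    (\<forall>x\<in>X. f (x, False) \<in> {x, act x s} \<and> f (x, True) \<in> insert x (act x ` S'))"
proof -
  interpret transitive_right_action G X act by fact
  define R where "R = {((x, b), y). x \<in> X \<and>
     y \<in> (if b then insert x (act x ` S') else {x, act x s})}"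
  have "hall_condition (X \<times> UNIV) R"
    unfolding hall_condition_def
  proof (intro allI impI, elim conjE)
    fix J assume J: "finite J" "J \<subseteq> X \<times> (UNIV :: bool set)"
    define A B V where "A = {x. (x, False) \<in> J}" and "B = {x. (x, True) \<in> J}" and "V = R `` J"
    have "A \<subseteq> fst ` J" "B \<subseteq> fst ` J" by (force simp: A_def B_def)+
    then have fin: "finite A" "finite B" using J finite_subset by blast+
    have AB: "A \<subseteq> X" "B \<subseteq> X" using J by (auto simp: A_def B_def)
    have "J = A \<times> {False} \<union> B \<times> {True}"
      unfolding A_def B_def by auto (metis (full_types))+
    also have "card \<dots> = card (A \<times> {False}) + card (B \<times> {True})"
      using fin by (intro card_Un_disjoint) auto
    finally have cardJ: "card J = card A + card B"
      by (simp add: card_cartesian_product)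
    have "V = (\<Union>x\<in>A. R `` {(x, False)}) \<union> (\<Union>x\<in>B. R `` {(x, True)})"
      unfolding V_def by (subst \<open>J = _\<close>) blast
    also have "\<dots> = (\<Union>x\<in>A. {x, act x s}) \<union> (\<Union>x\<in>B. insert x (act x ` S'))"
      using AB by (intro arg_cong2[of _ _ _ _ "(\<union>)"] SUP_cong refl) (auto simp: R_def)
    finally have V: "V = (\<Union>x\<in>A. {x, act x s}) \<union> (\<Union>x\<in>B. insert x (act x ` S'))" .
    have "finite V" unfolding V using fin S' by blast
    have "V \<subseteq> X"
      using AB S' basis_in_carrier unfolding V by (auto intro!: act_closed)
    have "card A \<le> card V" "card B \<le> card V"
      using \<open>finite V\<close> by (auto intro!: card_mono simp: V)
    show "card J \<le> card (R `` J)"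
    proof (cases "A = {} \<or> B = {}")
      case True
      then show ?thesis
        using \<open>card A \<le> card V\<close> \<open>card B \<le> card V\<close> cardJ by (auto simp: V_def)
    next
      case False
      have "card (A \<times> {s} \<union> B \<times> S') + 1 \<le> card V + card T"
        using False AB S' \<open>finite V\<close> \<open>V \<subseteq> X\<close>
        by (intro sparse_orbit_graph[OF assms(1-5)]) (auto simp: V)
      also have "A \<times> {s} \<inter> B \<times> S' = {}" using S' by auto
      then have "card (A \<times> {s} \<union> B \<times> S') = card A + card B * card S'"
        using fin S' by (subst card_Un_disjoint) (auto simp: card_cartesian_product)
      finally have "card A + card B * card S' + 1 \<le> card V + card S'"
        using S' by simp
      moreover obtain b c where "card B = Suc b" "card S' = Suc c"
        using False fin S' by (metis card_eq_0_iff not0_implies_Suc)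
      ultimately show ?thesis
        using cardJ by (simp add: V_def)
    qed
  qed
  moreover have "finite (R `` {i})" for i
  proof -
    have "R `` {i} \<subseteq> insert (fst i) (insert (act (fst i) s) (act (fst i) ` S'))"
      by (cases i) (auto simp: R_def split: if_splits)
    then show ?thesis using S' finite_subset by blast
  qed
  ultimately obtain f where f: "inj_on f (X \<times> UNIV)" "\<forall>i\<in>X \<times> UNIV. (i, f i) \<in> R"
    using distinct_representatives[of "X \<times> UNIV" R] by blast
  have "f (x, False) \<in> {x, act x s} \<and> f (x, True) \<in> insert x (act x ` S')" if "x \<in> X" for x
    using f(2)[rule_format, of "(x, False)"] f(2)[rule_format, of "(x, True)"] that
    by (simp add: R_def)
  with f(1) show ?thesis by blast
qed

end

section \<open>Connecting infinitely many orbits with one generator\<close>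

lemma bij_betw_label_index:
  fixes l :: "'x \<Rightarrow> nat"
  assumes "countable U" "\<And>i. infinite {x\<in>U. l x = i}"
  shows "bij_betw (\<lambda>x. (l x, to_nat_on {y\<in>U. l y = l x} x)) U UNIV"
proof -
  have cnt: "countable {y\<in>U. l y = i}" for i
    using assms(1) by (rule countable_subset[rotated]) auto
  have "inj_on (\<lambda>x. (l x, to_nat_on {y\<in>U. l y = l x} x)) U"
  proof (rule inj_onI)
    fix x y assume "x \<in> U" "y \<in> U"
      "(l x, to_nat_on {z\<in>U. l z = l x} x) = (l y, to_nat_on {z\<in>U. l z = l y} y)"
    then have "l x = l y" "to_nat_on {z\<in>U. l z = l y} x = to_nat_on {z\<in>U. l z = l y} y"
      by auto
    then show "x = y"
      using to_nat_on_inj[OF cnt[of "l y"], of x y] \<open>x \<in> U\<close> \<open>y \<in> U\<close> by blast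
  qed
  moreover have "\<exists>x\<in>U. (i, n) = (l x, to_nat_on {y\<in>U. l y = l x} x)" for i n
    using to_nat_on_surj[OF cnt[of i] assms(2)[of i], of n] by auto
  ultimately show ?thesis
    by (auto simp: bij_betw_def image_iff)
qed

text \<open>
  Number the points with each label. Exchanging label and number is then a bijection that leads from
  every label to every label.
\<close>

lemma connecting_bijection:
  fixes l :: "'x \<Rightarrow> nat"
  assumes "countable U" "\<And>i. infinite {x\<in>U. l x = i}"
    and "countable W" "\<And>i. infinite {x\<in>W. l x = i}"
  shows "\<exists>\<tau>. bij_betw \<tau> U W \<and> (\<forall>i j. \<exists>x\<in>U. l x = i \<and> l (\<tau> x) = j)"
proof -
  define a b where "a = (\<lambda>x. (l x, to_nat_on {y\<in>U. l y = l x} x))"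
    and "b = (\<lambda>x. (l x, to_nat_on {y\<in>W. l y = l x} x))"
  have a: "bij_betw a U UNIV" and b: "bij_betw b W UNIV"
    unfolding a_def b_def using assms by (auto intro!: bij_betw_label_index)
  define \<tau> where "\<tau> = inv_into W b \<circ> (prod.swap \<circ> a)"
  have "bij_betw \<tau> U W"
    unfolding \<tau>_def using bij_betw_trans[OF bij_betw_trans[OF a bij_swap] bij_betw_inv_into[OF b]] .
  moreover have "\<exists>x\<in>U. l x = i \<and> l (\<tau> x) = j" for i j
  proof -
    obtain x where x: "x \<in> U" "a x = (i, j)"
      using a by (metis bij_betw_imp_surj_on UNIV_I imageE)
    have "b (\<tau> x) = (j, i)"
      using b x by (simp add: \<tau>_def f_inv_into_f bij_betw_def)
    with x show ?thesis by (auto simp: a_def b_def)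
  qed
  ultimately show ?thesis by blast
qed

context free_on
begin

lemma right_action_inv_agree:
  assumes "right_action G X act" "right_action G X act'" "x \<in> X" "g \<in> carrier G"
    and "act' (act x (inv g)) g = act (act x (inv g)) g"
  shows "act' x (inv g) = act x (inv g)"
proof -
  interpret a: right_action G X act by fact
  interpret a': right_action G X act' by fact
  let ?y = "act x (inv g)"
  have y: "?y \<in> X" using assms by (simp add: a.act_closed)
  have "act ?y g = x" using assms a.act_mult[of x "inv g" g] by (simp add: a.act_one)
  then have "act' x (inv g) = act' (act' ?y g) (inv g)" using assms by simp
  also have "\<dots> = ?y" using y assms a'.act_mult[of ?y g "inv g"] by (simp add: a'.act_one)
  finally show ?thesis .
qed

lemma right_actions_agree_on_generate:
  assumes "right_action G X act" "right_action G X act'" "A \<subseteq> carrier G"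
    and agree: "\<And>x s. x \<in> X \<Longrightarrow> s \<in> A \<Longrightarrow> act' x s = act x s"
    and "g \<in> generate G A" "x \<in> X"
  shows "act' x g = act x g"
proof -
  interpret a: right_action G X act by fact
  interpret a': right_action G X act' by fact
  show ?thesis
    using assms(5,6)
  proof (induction g arbitrary: x rule: generate.induct)
    case one
    then show ?case by (simp add: a.act_one a'.act_one)
  next
    case (incl h)
    then show ?case by (simp add: agree)
  next
    case (inv h)
    then have "h \<in> carrier G" using assms(3) by auto
    with inv show ?case
      using right_action_inv_agree[OF assms(1,2), of x h] agree[of "act x (inv h)" h] a.act_closed
      by simp
  next
    case (eng g h)
    then have "g \<in> carrier G" "h \<in> carrier G" using generate_in_carrier assms(3) by blast+
    with eng show ?case by (simp add: a.act_mult a'.act_mult a.act_closed)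
  qed
qed

text \<open>
  Reading \<open>t\<close> or its inverse along a path inside \<open>C\<close> only uses values of \<open>t\<close> at points of \<open>C\<close>. This
  is why both ends of every step are required to lie in \<open>C\<close>.
\<close>

lemma right_actions_agree_along_word:
  assumes "right_action G X act" "right_action G X act'" "t \<in> S" "C \<subseteq> X"
    and basis_agree: "\<And>x s. x \<in> X \<Longrightarrow> s \<in> S - {t} \<Longrightarrow> act' x s = act x s"
    and t_agree: "\<And>x. x \<in> C \<Longrightarrow> act' x t = act x t"
    and "w \<in> wordset" "x \<in> X" "\<And>u v. w = u @ v \<Longrightarrow> act x (word_value G u) \<in> C"
  shows "act' x (word_value G w) = act x (word_value G w)"
proof -
  interpret a: right_action G X act by fact
  interpret a': right_action G X act' by fact
  show ?thesis
    using assms(7,9)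
  proof (induction w rule: rev_induct)
    case Nil
    then show ?case using \<open>x \<in> X\<close> by (simp add: a.act_one a'.act_one)
  next
    case (snoc a w)
    let ?g = "word_value G w" and ?h = "letter_value a" and ?y = "act x (word_value G w)"
    have w: "w \<in> wordset" and a: "a \<in> S \<times> UNIV" using snoc.prems(1) by auto
    have closed: "?g \<in> carrier G" "?h \<in> carrier G"
      using w a by (auto intro: word_value_closed letter_value_closed)
    have val: "word_value G (w @ [a]) = ?g \<otimes> ?h"
      using w a closed word_value_append[of w "[a]"] by simp
    have yC: "?y \<in> C" using snoc.prems(2)[of w "[a]"] by simp
    then have yX: "?y \<in> X" using assms(4) by auto
    have zC: "act ?y ?h \<in> C"
      using snoc.prems(2)[of "w @ [a]" "[]"] \<open>x \<in> X\<close> closed by (simp add: val a.act_mult)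
    have "act' x ?g = ?y"
    proof (rule snoc.IH[OF w])
      show "act x (word_value G u) \<in> C" if "w = u @ v" for u v
        using snoc.prems(2)[of u "v @ [a]"] that by simp
    qed
    moreover have "act' ?y ?h = act ?y ?h"
    proof (cases "fst a = t")
      case False
      then have "fst a \<in> S - {t}" using a by auto
      then have "?h \<in> generate G (S - {t})"
        by (auto simp: letter_value_def intro: generate.incl generate.inv)
      moreover have "S - {t} \<subseteq> carrier G" using basis_in_carrier by auto
      ultimately show ?thesis
        using right_actions_agree_on_generate[OF assms(1,2) _ basis_agree] yX by blast
    next
      case True
      have "t \<in> carrier G" using assms(3) basis_in_carrier by simp
      then show ?thesis
        using True yC zC yX t_agree right_action_inv_agree[OF assms(1,2) yX, of t]
        by (cases "snd a") (auto simp: letter_value_def)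
    qed
    ultimately show ?case
      using \<open>x \<in> X\<close> closed by (simp add: val a.act_mult a'.act_mult)
  qed
qed

text \<open>
  Redefine the generator \<open>t\<close> outside \<open>C\<close> by a connecting bijection for the orbits of the other
  generators. These orbits are infinite and meet \<open>C\<close> in finite sets, so there is room for it.
\<close>

lemma make_transitive:
  assumes "right_action G X act" "countable X" "t \<in> S" "C \<subseteq> X"
    and many: "infinite ((\<lambda>x. act x ` generate G (S - {t})) ` X)"
    and large: "\<And>x. x \<in> X \<Longrightarrow> infinite (act x ` generate G (S - {t}))"
    and C_small: "\<And>x. x \<in> X \<Longrightarrow> finite (C \<inter> act x ` carrier G)"
  shows "\<exists>act'. transitive_right_action G X act' \<and>
     (\<forall>x\<in>X. \<forall>s\<in>S - {t}. act' x s = act x s) \<and> (\<forall>x\<in>C. act' x t = act x t)"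
proof -
  interpret right_action G X act by fact
  let ?H = "generate G (S - {t})"
  have S_carrier: "S - {t} \<subseteq> carrier G" "t \<in> carrier G" using basis_in_carrier assms(3) by auto
  interpret H: subgroup ?H G by (rule generate_is_subgroup[OF S_carrier(1)])
  define orbit where "orbit x = act x ` ?H" for x
  have orbit_refl: "x \<in> orbit x" if "x \<in> X" for x
    unfolding orbit_def using act_one[OF that] by (intro image_eqI[of _ _ \<one>]) auto
  have orbit_eq: "orbit y = orbit x" if xy: "x \<in> X" "y \<in> orbit x" for x y
  proof -
    obtain h where h: "h \<in> ?H" "y = act x h" using xy by (auto simp: orbit_def)
    have forward: "act y k = act x (h \<otimes> k)" if "k \<in> ?H" for k
      using that h xy(1) by (simp add: act_mult)
    have backward: "act x k = act y (inv h \<otimes> k)" if "k \<in> ?H" for k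
    proof -
      have "act y (inv h \<otimes> k) = act x (h \<otimes> (inv h \<otimes> k))"
        using forward[of "inv h \<otimes> k"] that h(1) by simp
      also have "h \<otimes> (inv h \<otimes> k) = k"
        using that h(1) by (simp add: m_assoc[symmetric])
      finally show ?thesis by simp
    qed
    show ?thesis
      unfolding orbit_def
    proof (intro subset_antisym image_subsetI)
      show "act y k \<in> act x ` ?H" if "k \<in> ?H" for k
        unfolding forward[OF that] using that h(1) by (intro imageI) simp
      show "act x k \<in> act y ` ?H" if "k \<in> ?H" for k
        unfolding backward[OF that] using that h(1) by (intro imageI) simp
    qed
  qed
  have orbit_sub: "orbit x \<subseteq> X" "orbit x \<subseteq> act x ` carrier G" if "x \<in> X" for x
    using that H.mem_carrier act_closed by (auto simp: orbit_def)
  define l where "l x = to_nat_on (orbit ` X) (orbit x)" for x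
  have orbits: "countable (orbit ` X)" "infinite (orbit ` X)"
    using assms(2) many by (auto simp: orbit_def)
  have same_label: "orbit x = orbit y" if "l x = l y" "x \<in> X" "y \<in> X" for x y
    using that orbits by (simp add: l_def)
  have label_orbit: "l y = l x" if "x \<in> X" "y \<in> orbit x" for x y
    using orbit_eq[OF that] by (simp add: l_def)
  (* Since t keeps its values on C, its new values elsewhere have to fill the complement of D. *)
  define D where "D = (\<lambda>x. act x t) ` C"
  have "D \<subseteq> X" using assms(4) S_carrier act_closed by (auto simp: D_def)
  have D_small: "finite (D \<inter> act x ` carrier G)" if "x \<in> X" for x
  proof (rule finite_subset)
    show "D \<inter> act x ` carrier G \<subseteq> (\<lambda>y. act y t) ` (C \<inter> act x ` carrier G)"
    proof
      fix z assume "z \<in> D \<inter> act x ` carrier G"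
      then obtain y g where yg: "y \<in> C" "z = act y t" "g \<in> carrier G" "z = act x g"
        by (auto simp: D_def)
      have "y = act x (g \<otimes> inv t)"
        using yg that assms(4) S_carrier act_mult[of x g "inv t"] act_mult[of y t "inv t"]
        by (auto simp: act_one)
      then show "z \<in> (\<lambda>y. act y t) ` (C \<inter> act x ` carrier G)"
        using yg S_carrier by blast
    qed
  qed (use C_small[OF that] in simp)
  have room: "infinite {x \<in> X - B. l x = i}"
    if B: "\<And>x. x \<in> X \<Longrightarrow> finite (B \<inter> act x ` carrier G)" for B i
  proof -
    obtain x where x: "x \<in> X" "l x = i"
      using to_nat_on_surj[OF orbits, of i] by (auto simp: l_def)
    have "infinite (orbit x - (B \<inter> act x ` carrier G))"
      using large[OF x(1)] B[OF x(1)] unfolding orbit_def by (rule Diff_infinite_finite[rotated])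
    moreover have "orbit x - (B \<inter> act x ` carrier G) \<subseteq> {x \<in> X - B. l x = i}"
      using orbit_sub[OF x(1)] label_orbit[OF x(1)] x(2) by blast
    ultimately show ?thesis using finite_subset by blast
  qed
  obtain \<tau> where \<tau>: "bij_betw \<tau> (X - C) (X - D)"
    and connect: "\<And>i j. \<exists>x\<in>X - C. l x = i \<and> l (\<tau> x) = j"
    using connecting_bijection[of "X - C" l "X - D"] assms(2) room[OF C_small] room[OF D_small]
    by (metis countable_Diff)
  define \<theta> where "\<theta> x = (if x \<in> C then act x t else \<tau> x)" for x
  have "bij_betw \<theta> C D"
  proof -
    have "inj_on (\<lambda>x. act x t) C"
    proof (rule inj_on_inverseI[of _ "\<lambda>y. act y (inv t)"])
      show "act (act x t) (inv t) = x" if "x \<in> C" for x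
        using that assms(4) S_carrier act_mult[of x t "inv t"] by (auto simp: act_one)
    qed
    then show ?thesis by (auto simp: bij_betw_def D_def \<theta>_def inj_on_def)
  qed
  moreover have "bij_betw \<theta> (X - C) (X - D)"
    using \<tau> by (rule bij_betw_cong[THEN iffD1, rotated]) (simp add: \<theta>_def)
  ultimately have "bij_betw \<theta> (C \<union> (X - C)) (D \<union> (X - D))"
    by (rule bij_betw_combine) auto
  then have \<theta>: "bij_betw \<theta> X X"
    using assms(4) \<open>D \<subseteq> X\<close> by (simp add: Un_absorb1)
  define \<sigma> where "\<sigma> s b x = (if s = t then if b then \<theta> x else inv_into X \<theta> x
     else act x (if b then s else inv s))" for s b x
  have "permutation_family X \<sigma>"
    unfolding permutation_family_def
  proof (intro ballI allI)
    fix s b x assume "s \<in> S" "x \<in> X"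
    then show "\<sigma> s b x \<in> X \<and> \<sigma> s (\<not> b) (\<sigma> s b x) = x"
      using bij_betwE[OF \<theta>] bij_betwE[OF bij_betw_inv_into[OF \<theta>]] basis_in_carrier[of s]
        bij_betw_inv_into_left[OF \<theta>] bij_betw_inv_into_right[OF \<theta>]
        act_mult[of x s "inv s"] act_mult[of x "inv s" s]
      by (simp add: \<sigma>_def act_closed act_one)
  qed
  note family = this
  define act' where "act' = induced_action \<sigma>"
  have act': "right_action G X act'"
    unfolding act'_def using family by (rule right_action_induced_action)
  interpret a': right_action G X act' by (rule act')
  have agree: "act' x s = act x s" if "x \<in> X" "s \<in> S - {t}" for x s
    using induced_action_letter(1)[OF family] that by (simp add: act'_def \<sigma>_def)
  have act'_t: "act' x t = \<theta> x" if "x \<in> X" for x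
    using induced_action_letter(1)[OF family assms(3) that] by (simp add: act'_def \<sigma>_def)
  have agree_H: "act' x h = act x h" if "x \<in> X" "h \<in> ?H" for x h
    using right_actions_agree_on_generate[OF assms(1) act' S_carrier(1) agree] that by blast
  have "transitive_right_action G X act'"
  proof (unfold_locales)
    show "X \<noteq> {}" using many by auto
    fix x y assume xy: "x \<in> X" "y \<in> X"
    obtain z where z: "z \<in> X - C" "l z = l x" "l (\<tau> z) = l y" using connect by blast
    have \<tau>z: "\<tau> z \<in> X" using bij_betwE[OF \<tau>] z(1) by blast
    obtain g where g: "g \<in> ?H" "z = act x g"
      using same_label[OF z(2)] orbit_refl[of z] xy z(1) by (auto simp: orbit_def)
    obtain h where h: "h \<in> ?H" "y = act (\<tau> z) h"
      using same_label[OF z(3) \<tau>z] orbit_refl[of y] xy by (auto simp: orbit_def)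
    have "act' x (g \<otimes> t \<otimes> h) = act' (act' (act' x g) t) h"
      using xy g h H.mem_carrier S_carrier by (simp add: a'.act_mult a'.act_closed)
    also have "\<dots> = y"
      using xy g h z \<tau>z by (simp add: agree_H act'_t \<theta>_def)
    finally show "\<exists>k\<in>carrier G. act' x k = y"
      using g h H.mem_carrier S_carrier by blast
  qed
  moreover have "act' x t = act x t" if "x \<in> C" for x
    using act'_t[of x] assms(4) that by (auto simp: \<theta>_def)
  ultimately show ?thesis using agree by blast
qed

end

section \<open>An action with many fixed points and two disjoint injections\<close>

context group
begin

lemma transitive_coset_action:
  assumes "subgroup H G"
  shows "transitive_right_action G (rcosets H) (\<lambda>C g. C #> g)"
proof -
  interpret H: subgroup H G by fact
  have coset: "H #> g #> h = H #> (g \<otimes> h)" if "g \<in> carrier G" "h \<in> carrier G" for g h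
    using that by (simp add: coset_mult_assoc H.subset)
  show ?thesis
  proof unfold_locales
    show "rcosets H \<noteq> {}" using H.subgroup_in_rcosets[OF is_group] by auto
  next
    fix C D assume "C \<in> rcosets H" "D \<in> rcosets H"
    then obtain g h where "g \<in> carrier G" "h \<in> carrier G" "C = H #> g" "D = H #> h"
      by (auto simp: RCOSETS_def)
    then show "\<exists>k\<in>carrier G. C #> k = D"
      by (intro bexI[of _ "inv g \<otimes> h"]) (simp_all add: coset m_assoc[symmetric])
  qed (auto simp: RCOSETS_def coset m_assoc)
qed

lemma coset_stabilizer:
  "subgroup H G \<Longrightarrow> g \<in> carrier G \<Longrightarrow> H #> g = H \<longleftrightarrow> g \<in> H"
  using coset_join1 coset_join2 by metis

end

context free_on
begin

text \<open>
  The points are the cosets of the subgroups generated by few elements, with a separate copy of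
  each coset space for every number \<open>n\<close>. Only \<open>t\<close> has to be changed in order to connect these
  copies. In copy \<open>n\<close> it stays as it is in the ball of radius \<open>n\<close> around the subgroup itself, so
  generators with at most \<open>n\<close> letters still fix the centre. The trivial subgroup makes the action
  faithful. The injections are built from \<open>s\<close> and \<open>S'\<close> alone, and so survive the change.
\<close>

lemma sparse_action_exists:
  fixes s t :: 'g and S' :: "'g set"
  assumes cnt: "countable (carrier G)"
    and S: "S = insert s (insert t S')" "finite S'" "S' \<noteq> {}" "s \<noteq> t" "s \<notin> S'" "t \<notin> S'"
  shows "\<exists>(X :: (('g set \<times> nat) \<times> 'g set) set) act.
     countable X \<and> faithful_right_action G X act \<and> transitive_right_action G X act \<and>
     (\<forall>T. finite T \<and> T \<subseteq> carrier G \<and> card T \<le> card S' \<longrightarrow> (\<exists>x\<in>X. \<forall>g\<in>T. act x g = x)) \<and>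
     (\<exists>f. inj_on f (X \<times> UNIV) \<and>
       (\<forall>x\<in>X. f (x, False) \<in> {x, act x s} \<and> f (x, True) \<in> insert x (act x ` S')))"
proof -
  define small where "small T \<longleftrightarrow> finite T \<and> T \<subseteq> carrier G \<and> card T \<le> card S'" for T
  define X where "X = {((T, n::nat), C). small T \<and> C \<in> rcosets (generate G T)}"
  define act where "act x g = (fst x, snd x #> g)" for x :: "('g set \<times> nat) \<times> 'g set" and g
  define centre where "centre T n = ((T, n::nat), generate G T)" for T n
  have small_empty: "small {}" by (simp add: small_def)
  have subgr: "subgroup (generate G T) G" if "small T" for T
    using that generate_is_subgroup by (simp add: small_def)
  have coset_action: "transitive_right_action G (rcosets (generate G T)) (\<lambda>C g. C #> g)"
    if "small T" for T
    using transitive_coset_action[OF subgr[OF that]] .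
  have stabilizer: "generate G T #> g = generate G T \<longleftrightarrow> g \<in> generate G T"
    if "small T" "g \<in> carrier G" for T g
    using coset_stabilizer[OF subgr[OF that(1)] that(2)] .
  have base: "generate G T \<in> rcosets (generate G T)" if "small T" for T
    using subgroup.subgroup_in_rcosets[OF subgr[OF that] is_group] .
  have centre_X: "centre T n \<in> X" if "small T" for T n
    using base[OF that] that by (simp add: centre_def X_def)
  have action: "right_action G X act"
  proof unfold_locales
    note coset_right = transitive_right_action.axioms(1)[OF coset_action]
    show "act x g \<in> X" if "x \<in> X" "g \<in> carrier G" for x g
      using that right_action.act_closed[OF coset_right] by (auto simp: X_def act_def)
    show "act x \<one> = x" if "x \<in> X" for x
      using that right_action.act_one[OF coset_right] by (auto simp: X_def act_def)
    show "act x (g \<otimes> h) = act (act x g) h" if "x \<in> X" "g \<in> carrier G" "h \<in> carrier G" for x g h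
      using that right_action.act_mult[OF coset_right] by (fastforce simp: X_def act_def)
  qed
  interpret right_action G X act by (rule action)
  have S_carrier: "S \<subseteq> carrier G" using basis_in_carrier by auto
  have others: "S - {t} = insert s S'" using S by auto
  have card_others: "card (S - {t}) = Suc (card S')" unfolding others using S by simp
  have countable_X: "countable X"
  proof -
    have "X \<subseteq> (SIGMA i : {T. finite T \<and> T \<subseteq> carrier G} \<times> UNIV. rcosets (generate G (fst i)))"
      by (auto simp: X_def small_def)
    moreover have "countable (rcosets (generate G T))" for T
      using cnt by (simp add: RCOSETS_def)
    ultimately show ?thesis
      by (auto intro!: countable_SIGMA countable_Collect_finite_subset[OF cnt] elim!: countable_subset)
  qed
  have large: "infinite (act x ` generate G (S - {t}))" if x: "x \<in> X" for x
  proof -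
    obtain T n C where T: "x = ((T, n), C)" "small T" "C \<in> rcosets (generate G T)"
      using x by (auto simp: X_def)
    interpret T: transitive_right_action G "rcosets (generate G T)" "\<lambda>C g. C #> g"
      using coset_action[OF T(2)] .
    let ?H = "generate G (S - {t})"
    have H: "?H \<subseteq> carrier G" using S_carrier by (intro generate_incl) auto
    have "infinite ((\<lambda>g. C #> g) ` ?H)"
    proof (rule infinite_invariant_subset[OF coset_action[OF T(2)] base[OF T(2)], of T "S - {t}"])
      show "finite T" "T \<subseteq> carrier G" "card T < card (S - {t})"
        using T(2) card_others by (auto simp: small_def)
      show "(\<lambda>g. C #> g) ` ?H \<subseteq> rcosets (generate G T)"
        using T(3) H T.act_closed by blast
      show "(\<lambda>g. C #> g) ` ?H \<noteq> {}" using generate.one by blast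
      fix D a assume "D \<in> (\<lambda>g. C #> g) ` ?H" and a: "a \<in> S - {t}"
      then obtain h where h: "h \<in> ?H" "D = C #> h" by auto
      have "D #> a = C #> (h \<otimes> a)"
        using h a H S_carrier T(3) T.act_mult by (metis DiffD1 subsetD)
      then show "D #> a \<in> (\<lambda>g. C #> g) ` ?H"
        using h(1) a by (auto intro: generate.eng generate.incl)
    qed (use stabilizer[OF T(2)] in auto)
    moreover have "(\<lambda>g. C #> g) ` ?H = snd ` act x ` ?H"
      by (simp add: T(1) act_def image_image)
    ultimately show ?thesis using finite_imageI by metis
  qed
  have many: "infinite ((\<lambda>x. act x ` generate G (S - {t})) ` X)"
  proof
    let ?O = "\<lambda>x. act x ` generate G (S - {t})"
    assume "finite (?O ` X)"
    moreover have "range (\<lambda>n. ?O (centre {} n)) \<subseteq> ?O ` X"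
      using centre_X[OF small_empty] by auto
    moreover have "inj (\<lambda>n. ?O (centre {} n))"
    proof (rule injI)
      fix m n assume "?O (centre {} m) = ?O (centre {} n)"
      moreover have "act (centre {} m) \<one> \<in> ?O (centre {} m)" using generate.one by blast
      ultimately obtain h where "act (centre {} m) \<one> = act (centre {} n) h" by auto
      then show "m = n" by (simp add: act_def centre_def)
    qed
    ultimately show False
      using finite_subset range_inj_infinite by blast
  qed
  (* the union of the balls of radius n around the centres of the copies with number n *)
  define B where "B = {act (centre T n) (word_value G w) | T n w.
     small T \<and> w \<in> wordset \<and> length w \<le> n}"
  have B_X: "B \<subseteq> X"
    unfolding B_def using act_closed[OF centre_X word_value_closed] by blast
  have B_small: "finite (B \<inter> act x ` carrier G)" for x
  proof (rule finite_subset)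
    let ?n = "snd (fst x)"
    show "B \<inter> act x ` carrier G \<subseteq>
        (\<lambda>w. act (centre (fst (fst x)) ?n) (word_value G w)) ` {w. set w \<subseteq> S \<times> UNIV \<and> length w \<le> ?n}"
    proof
      fix y assume y: "y \<in> B \<inter> act x ` carrier G"
      then obtain T n w where w: "y = act (centre T n) (word_value G w)" "w \<in> wordset" "length w \<le> n"
        by (auto simp: B_def)
      from y obtain g where "y = act x g" by blast
      with w(1) have "fst (fst x) = T" "?n = n" by (auto simp: act_def centre_def)
      with w show "y \<in> (\<lambda>w. act (centre (fst (fst x)) ?n) (word_value G w)) `
          {w. set w \<subseteq> S \<times> UNIV \<and> length w \<le> ?n}"
        by (intro image_eqI[of _ _ w]) auto
    qed
    show "finite ((\<lambda>w. act (centre (fst (fst x)) ?n) (word_value G w)) `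
        {w. set w \<subseteq> S \<times> UNIV \<and> length w \<le> ?n})"
      using S(1,2) by (intro finite_imageI finite_lists_length_le) auto
  qed
  have t: "t \<in> S" using S(1) by simp
  obtain act' where act': "transitive_right_action G X act'"
    and agree: "\<And>x a. x \<in> X \<Longrightarrow> a \<in> S - {t} \<Longrightarrow> act' x a = act x a"
    and agree_B: "\<And>x. x \<in> B \<Longrightarrow> act' x t = act x t"
    using make_transitive[OF action countable_X t B_X many large B_small] by blast
  interpret a': transitive_right_action G X act' by (rule act')
  have near_centre: "act' (centre T n) g = act (centre T n) g"
    if "small T" "g \<in> carrier G" "length (reduced_form g) \<le> n" for T n g
  proof -
    have "act (centre T n) (word_value G u) \<in> B" if "reduced_form g = u @ v" for u v
    proof -
      have "u \<in> wordset" "length u \<le> n"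
        using reduced_form(1)[OF \<open>g \<in> carrier G\<close>] \<open>length (reduced_form g) \<le> n\<close> that by auto
      then show ?thesis using \<open>small T\<close> unfolding B_def by blast
    qed
    then have "act' (centre T n) (word_value G (reduced_form g)) =
        act (centre T n) (word_value G (reduced_form g))"
      by (intro right_actions_agree_along_word[OF action a'.right_action_axioms t B_X])
        (use agree agree_B reduced_form(1)[OF \<open>g \<in> carrier G\<close>] centre_X[OF \<open>small T\<close>] in blast)+
    then show ?thesis
      using reduced_form(3)[OF \<open>g \<in> carrier G\<close>] by simp
  qed
  have "faithful_right_action G X act'"
  proof unfold_locales
    fix g assume g: "g \<in> carrier G" "\<And>x. x \<in> X \<Longrightarrow> act' x g = x"
    have "act (centre {} (length (reduced_form g))) g = centre {} (length (reduced_form g))"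
      using near_centre[OF small_empty g(1) order_refl] g(2) centre_X[OF small_empty] by metis
    then have "g \<in> generate G {}"
      using stabilizer[OF small_empty g(1)] by (simp add: act_def centre_def)
    then show "g = \<one>" by (simp add: generate_empty)
  qed
  moreover have "\<exists>x\<in>X. \<forall>g\<in>T. act' x g = x" if T: "small T" for T
  proof -
    (* a radius that covers the reduced words of all elements of T, also when T is empty *)
    define n where "n = Max (insert 0 ((length \<circ> reduced_form) ` T))"
    have "act' (centre T n) g = centre T n" if "g \<in> T" for g
    proof -
      have "g \<in> carrier G" "length (reduced_form g) \<le> n"
        using T that by (auto simp: small_def n_def)
      then have "act' (centre T n) g = act (centre T n) g"
        using near_centre[OF T] by blast
      also have "\<dots> = centre T n"
        using stabilizer[OF T \<open>g \<in> carrier G\<close>] generate.incl[OF that] by (simp add: act_def centre_def)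
      finally show ?thesis .
    qed
    with centre_X[OF T] show ?thesis by blast
  qed
  moreover have "\<exists>f. inj_on f (X \<times> UNIV) \<and>
       (\<forall>x\<in>X. f (x, False) \<in> {x, act' x s} \<and> f (x, True) \<in> insert x (act' x ` S'))"
  proof -
    have "\<exists>f. inj_on f ((rcosets (generate G T)) \<times> UNIV) \<and> (\<forall>C\<in>rcosets (generate G T).
        f (C, False) \<in> {C, C #> s} \<and> f (C, True) \<in> insert C ((\<lambda>a. C #> a) ` S'))"
      if "small T" for T
      using two_disjoint_injections[OF coset_action[OF that] base[OF that], of T s S']
        stabilizer[OF that] that S by (auto simp: small_def)
    then obtain f where
      inj: "\<And>T. small T \<Longrightarrow> inj_on (f T) ((rcosets (generate G T)) \<times> UNIV)" and
      f: "\<And>T C. small T \<Longrightarrow> C \<in> rcosets (generate G T) \<Longrightarrow>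
        f T (C, False) \<in> {C, C #> s} \<and> f T (C, True) \<in> insert C ((\<lambda>a. C #> a) ` S')"
      by metis
    define F where "F z = (fst (fst z), f (fst (fst (fst z))) (snd (fst z), snd z))"
      for z :: "(('g set \<times> nat) \<times> 'g set) \<times> bool"
    have "inj_on F (X \<times> UNIV)"
    proof (rule inj_onI)
      fix z z' assume z: "z \<in> X \<times> UNIV" "z' \<in> X \<times> UNIV" "F z = F z'"
      obtain T n C b where zT: "z = (((T, n), C), b)" "small T" "C \<in> rcosets (generate G T)"
        using z(1) by (auto simp: X_def)
      obtain T' n' C' b' where
        zT': "z' = (((T', n'), C'), b')" "small T'" "C' \<in> rcosets (generate G T')"
        using z(2) by (auto simp: X_def)
      have eq: "T = T'" "n = n'" "f T (C, b) = f T (C', b')"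
        using z(3) by (auto simp: zT(1) zT'(1) F_def)
      have "(C, b) = (C', b')"
        using inj_onD[OF inj[OF zT(2)] eq(3)] zT(3) zT'(3) eq(1) by simp
      with eq show "z = z'" by (simp add: zT(1) zT'(1))
    qed
    moreover have "F (x, False) \<in> {x, act' x s} \<and> F (x, True) \<in> insert x (act' x ` S')" if x: "x \<in> X" for x
    proof -
      obtain T n C where T: "x = ((T, n), C)" "small T" "C \<in> rcosets (generate G T)"
        using x by (auto simp: X_def)
      have "act' x ` S' = act x ` S'" "act' x s = act x s"
        using agree[OF x] others by auto
      then show ?thesis
        using f[OF T(2,3)] by (auto simp: F_def T(1) act_def)
    qed
    ultimately show ?thesis by blast
  qed
  ultimately show ?thesis
    using countable_X act' unfolding small_def by blast
qed

end

section \<open>Bounds for the Tarski number\<close>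

context right_action
begin

lemma act_inv_cancel:
  "x \<in> X \<Longrightarrow> g \<in> carrier G \<Longrightarrow> act (act x g) (inv g) = x"
  using act_mult[of x g "inv g"] by (simp add: act_one)

lemma act_inj: "act x g = act y g \<Longrightarrow> x \<in> X \<Longrightarrow> y \<in> X \<Longrightarrow> g \<in> carrier G \<Longrightarrow> x = y"
  using act_inv_cancel by metis

text \<open>
  A point that is fixed by all quotients \<open>u i \<otimes> inv (u 0)\<close> is sent to the same place by all \<open>u i\<close>,
  so only its own piece can cover that place.
\<close>

lemma fixed_point_in_own_piece:
  assumes x: "x \<in> X" and u: "\<And>i. i < p \<Longrightarrow> u i \<in> carrier G" and "0 < (p::nat)"
    and R: "\<And>i. i < p \<Longrightarrow> R i \<subseteq> X" and cover: "X \<subseteq> (\<Union>i<p. (\<lambda>x. act x (u i)) ` R i)"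
    and fixed: "\<And>i. 0 < i \<Longrightarrow> i < p \<Longrightarrow> act x (u i \<otimes> inv (u 0)) = x"
  shows "\<exists>i<p. x \<in> R i"
proof -
  have u0: "u 0 \<in> carrier G" using u \<open>0 < p\<close> by simp
  have same: "act x (u i) = act x (u 0)" if i: "i < p" for i
  proof (cases "i = 0")
    case False
    then have "0 < i" by simp
    then have "act (act x (u i)) (inv (u 0)) = x"
      using fixed[of i] i x u[OF i] u0 by (simp add: act_mult)
    also have "x = act (act x (u 0)) (inv (u 0))"
      using x u0 by (simp add: act_inv_cancel)
    finally show ?thesis
      by (rule act_inj) (use x u[OF i] u0 act_closed in auto)
  qed simp
  have "act x (u 0) \<in> X" using x u0 by (rule act_closed)
  then obtain i y where i: "i < p" "y \<in> R i" "act x (u 0) = act y (u i)"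
    using cover by blast
  have "act x (u i) = act y (u i)" using same[OF i(1)] i(3) by simp
  then have "x = y" by (rule act_inj) (use x u[OF i(1)] R[OF i(1)] i(2) in auto)
  with i show ?thesis by blast
qed

text \<open>
  With too few pieces there are so few quotients that one point is fixed by those of both systems.
  It then lies in one of the \<open>P i\<close> and in one of the \<open>Q j\<close>.
\<close>

lemma tarski_number_ge:
  assumes fixed: "\<And>T. finite T \<Longrightarrow> T \<subseteq> carrier G \<Longrightarrow> card T \<le> q \<Longrightarrow> \<exists>x\<in>X. \<forall>g\<in>T. act x g = x"
  shows "enat (q + 3) \<le> tarski_number G X act"
  unfolding tarski_number_def paradoxical_decomposition_def
proof (rule Inf_greatest, elim CollectE exE conjE)
  fix z m n and P Q :: "nat \<Rightarrow> 'x set" and g h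
  assume z: "z = enat (m + n)" and mn: "0 < m" "0 < n"
    and P: "\<forall>i<m. P i \<subseteq> X \<and> g i \<in> carrier G" and Q: "\<forall>j<n. Q j \<subseteq> X \<and> h j \<in> carrier G"
    and disjoint: "\<forall>i<m. \<forall>j<n. P i \<inter> Q j = {}"
    and cover: "X = (\<Union>i<m. (\<lambda>x. act x (g i)) ` P i)" "X = (\<Union>j<n. (\<lambda>x. act x (h j)) ` Q j)"
  show "enat (q + 3) \<le> z"
  proof (rule ccontr)
    assume "\<not> enat (q + 3) \<le> z"
    then have few: "m + n \<le> q + 2" by (simp add: z)
    define A where "A = (\<lambda>i. g i \<otimes> inv (g 0)) ` {1..<m}"
    define B where "B = (\<lambda>j. h j \<otimes> inv (h 0)) ` {1..<n}"
    have "card A \<le> m - 1" "card B \<le> n - 1"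
      using card_image_le[of "{1..<m}" "\<lambda>i. g i \<otimes> inv (g 0)"]
        card_image_le[of "{1..<n}" "\<lambda>j. h j \<otimes> inv (h 0)"] by (simp_all add: A_def B_def)
    then have "card (A \<union> B) \<le> q"
      using card_Un_le[of A B] few mn by linarith
    moreover have "finite (A \<union> B)" by (simp add: A_def B_def)
    moreover have "A \<union> B \<subseteq> carrier G" using mn P Q by (auto simp: A_def B_def)
    ultimately have "\<exists>x\<in>X. \<forall>a\<in>A \<union> B. act x a = x"
      by (intro fixed)
    then obtain x where x: "x \<in> X" "\<And>a. a \<in> A \<union> B \<Longrightarrow> act x a = x"
      by blast
    have "\<exists>i<m. x \<in> P i"
      by (rule fixed_point_in_own_piece[OF x(1) _ mn(1) _ equalityD1[OF cover(1)]])
        (use P x(2) in \<open>auto simp: A_def\<close>)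
    moreover have "\<exists>j<n. x \<in> Q j"
      by (rule fixed_point_in_own_piece[OF x(1) _ mn(2) _ equalityD1[OF cover(2)]])
        (use Q x(2) in \<open>auto simp: B_def\<close>)
    ultimately show False using disjoint by blast
  qed
qed

text \<open>
  Half of a paradoxical decomposition amounts to an injection that moves each point by one of
  finitely many elements: the pieces collect the images according to the element that was used, and
  its inverse moves them back.
\<close>

lemma pieces_of_injection:
  assumes "inj_on p X" and u: "\<And>i. i < m \<Longrightarrow> u i \<in> carrier G"
    and p: "\<And>x. x \<in> X \<Longrightarrow> \<exists>i<m. p x = act x (u i)"
  shows "\<exists>P. disjoint_family_on P {..<m} \<and> (\<forall>i<m. P i \<subseteq> p ` X) \<and>
    X = (\<Union>i<m. (\<lambda>x. act x (inv (u i))) ` P i)"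
proof -
  obtain c where c: "\<And>x. x \<in> X \<Longrightarrow> c x < m" "\<And>x. x \<in> X \<Longrightarrow> p x = act x (u (c x))"
    using p by metis
  define P where "P i = p ` {x\<in>X. c x = i}" for i
  have "disjoint_family_on P {..<m}"
    using assms(1) by (auto simp: disjoint_family_on_def P_def inj_on_def)
  moreover have "P i \<subseteq> p ` X" for i
    by (auto simp: P_def)
  moreover have "X = (\<Union>i<m. (\<lambda>x. act x (inv (u i))) ` P i)"
  proof -
    have "act (p x) (inv (u (c x))) = x" if "x \<in> X" for x
      using that c u by (simp add: act_inv_cancel)
    then show ?thesis
      using c(1) by (force simp: P_def)
  qed
  ultimately show ?thesis by blast
qed

lemma tarski_number_le:
  assumes s: "s \<in> carrier G" and S': "S' \<subseteq> carrier G" "finite S'"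
    and f: "inj_on f (X \<times> UNIV)" "\<And>x. x \<in> X \<Longrightarrow> f (x, False) \<in> {x, act x s}"
      "\<And>x. x \<in> X \<Longrightarrow> f (x, True) \<in> insert x (act x ` S')"
  shows "tarski_number G X act \<le> enat (card S' + 3)"
proof -
  obtain e where e: "bij_betw e {1..card S'} S'"
    using ex_bij_betw_nat_finite_1[OF S'(2)] by blast
  define u where "u i = (if i = 0 then \<one> else s)" for i :: nat
  define v where "v i = (if i = 0 then \<one> else e i)" for i :: nat
  have u: "u i \<in> carrier G" for i using s by (simp add: u_def)
  have v: "v i \<in> carrier G" if "i < Suc (card S')" for i
    using that bij_betwE[OF e] S' by (auto simp: v_def)
  have inX: "f (x, b) \<in> X" if "x \<in> X" for x b
    using f(2,3)[OF that] that s S' act_closed by (cases b) auto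
  obtain P where P: "disjoint_family_on P {..<2}" "\<forall>i<2. P i \<subseteq> (\<lambda>x. f (x, False)) ` X"
    "X = (\<Union>i<2. (\<lambda>x. act x (inv (u i))) ` P i)"
  proof -
    have "\<exists>i<2. f (x, False) = act x (u i)" if "x \<in> X" for x
    proof (cases "f (x, False) = x")
      case True
      then show ?thesis using that by (intro exI[of _ 0]) (simp add: u_def act_one)
    next
      case False
      then show ?thesis using f(2)[OF that] by (intro exI[of _ 1]) (simp add: u_def)
    qed
    then show ?thesis
      using that pieces_of_injection[of "\<lambda>x. f (x, False)" 2 u] f(1) u by (auto simp: inj_on_def)
  qed
  obtain Q where Q: "disjoint_family_on Q {..<Suc (card S')}"
    "\<forall>i<Suc (card S'). Q i \<subseteq> (\<lambda>x. f (x, True)) ` X"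
    "X = (\<Union>i<Suc (card S'). (\<lambda>x. act x (inv (v i))) ` Q i)"
  proof -
    have "\<exists>i<Suc (card S'). f (x, True) = act x (v i)" if x: "x \<in> X" for x
    proof (cases "f (x, True) = x")
      case True
      then show ?thesis using that by (intro exI[of _ 0]) (simp add: v_def act_one)
    next
      case False
      then obtain a where a: "a \<in> S'" "f (x, True) = act x a" using f(3)[OF x] by auto
      then have "a \<in> e ` {1..card S'}" using e by (simp add: bij_betw_imp_surj_on)
      then obtain i where "i \<in> {1..card S'}" "e i = a" by blast
      with a show ?thesis by (intro exI[of _ i]) (auto simp: v_def)
    qed
    then show ?thesis
      using that pieces_of_injection[of "\<lambda>x. f (x, True)" "Suc (card S')" v] f(1) v
      by (auto simp: inj_on_def)
  qed
  have "P i \<inter> Q j = {}" if "i < 2" "j < Suc (card S')" for i j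
    using P(2) Q(2) that f(1) by (fastforce dest: inj_onD)
  moreover have "P i \<subseteq> X" if "i < 2" for i
    using P(2) that inX by blast
  moreover have "Q j \<subseteq> X" if "j < Suc (card S')" for j
    using Q(2) that inX by blast
  ultimately have
    "paradoxical_decomposition G X act 2 (Suc (card S')) P Q (\<lambda>i. inv (u i)) (\<lambda>j. inv (v j))"
    unfolding paradoxical_decomposition_def
    by (intro conjI P(1,3) Q(1,3) allI impI) (auto intro: inv_closed u v)
  then have "tarski_number G X act \<le> enat (2 + Suc (card S'))"
    unfolding tarski_number_def by (intro Inf_lower) blast
  then show ?thesis by (simp add: numeral_3_eq_3)
qed

end

section \<open>Change of the underlying set\<close>

lemma paradoxical_decomposition_image:
  assumes \<iota>: "bij_betw \<iota> X Y"
    and equivariant: "\<And>x g. x \<in> X \<Longrightarrow> g \<in> carrier G \<Longrightarrow> act' (\<iota> x) g = \<iota> (act x g)"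
    and "paradoxical_decomposition G X act m n P Q g h"
  shows "paradoxical_decomposition G Y act' m n (\<lambda>i. \<iota> ` P i) (\<lambda>j. \<iota> ` Q j) g h"
proof -
  note decomposition = assms(3)[unfolded paradoxical_decomposition_def]
  have mn: "0 < m" "0 < n"
    and P: "\<forall>i<m. P i \<subseteq> X \<and> g i \<in> carrier G" and Q: "\<forall>j<n. Q j \<subseteq> X \<and> h j \<in> carrier G"
    and disjoint: "disjoint_family_on P {..<m}" "disjoint_family_on Q {..<n}"
      "\<forall>i<m. \<forall>j<n. P i \<inter> Q j = {}"
    and cover: "(\<Union>i<m. (\<lambda>x. act x (g i)) ` P i) = X" "(\<Union>j<n. (\<lambda>x. act x (h j)) ` Q j) = X"
    using decomposition by metis+
  have inter: "\<iota> ` A \<inter> \<iota> ` B = \<iota> ` (A \<inter> B)" if "A \<subseteq> X" "B \<subseteq> X" for A B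
    using inj_on_image_Int[OF bij_betw_imp_inj_on[OF \<iota>] that] by simp
  have cover_image: "(\<Union>i<p. (\<lambda>y. act' y (u i)) ` \<iota> ` R i) = Y"
    if R: "\<forall>i<p. R i \<subseteq> X \<and> u i \<in> carrier G" and cover: "(\<Union>i<p. (\<lambda>x. act x (u i)) ` R i) = X"
    for p :: nat and u and R
  proof -
    have "(\<lambda>y. act' y (u i)) ` \<iota> ` R i = \<iota> ` (\<lambda>x. act x (u i)) ` R i" if "i < p" for i
      unfolding image_image using R that by (intro image_cong refl equivariant) auto
    then have "(\<Union>i<p. (\<lambda>y. act' y (u i)) ` \<iota> ` R i) = \<iota> ` (\<Union>i<p. (\<lambda>x. act x (u i)) ` R i)"
      by (simp add: image_UN)
    also have "\<dots> = Y"
      unfolding cover using \<iota> by (simp add: bij_betw_def)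
    finally show ?thesis .
  qed
  have "\<iota> ` A \<subseteq> Y" if "A \<subseteq> X" for A
    using \<iota> that by (auto simp: bij_betw_def)
  moreover have "disjoint_family_on (\<lambda>i. \<iota> ` P i) {..<m}" "disjoint_family_on (\<lambda>j. \<iota> ` Q j) {..<n}"
    using disjoint(1,2) P Q by (simp_all add: disjoint_family_on_def inter)
  moreover have "\<forall>i<m. \<forall>j<n. \<iota> ` P i \<inter> \<iota> ` Q j = {}"
    using disjoint(3) P Q by (simp add: inter)
  ultimately show ?thesis
    unfolding paradoxical_decomposition_def
    using mn P Q cover_image[OF P cover(1)] cover_image[OF Q cover(2)] by simp
qed

lemma tarski_number_le_of_bijection:
  assumes "bij_betw \<iota> X Y"
    and "\<And>x g. x \<in> X \<Longrightarrow> g \<in> carrier G \<Longrightarrow> act' (\<iota> x) g = \<iota> (act x g)"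
  shows "tarski_number G Y act' \<le> tarski_number G X act"
  unfolding tarski_number_def
proof (rule Inf_superset_mono)
  have "\<exists>P Q g h. paradoxical_decomposition G Y act' m n P Q g h"
    if "paradoxical_decomposition G X act m n P Q g h" for m n P Q g h
    using paradoxical_decomposition_image[where act = act and act' = act', OF assms that] by blast
  then show "{enat (m + n) |m n. \<exists>P Q g h. paradoxical_decomposition G X act m n P Q g h}
      \<subseteq> {enat (m + n) |m n. \<exists>P Q g h. paradoxical_decomposition G Y act' m n P Q g h}"
    by blast
qed

lemma countable_action_on_naturals:
  fixes X :: "'x set"
  assumes "countable X" "faithful_right_action G X act" "transitive_right_action G X act"
  shows "\<exists>(Y :: nat set) act'. faithful_right_action G Y act' \<and> transitive_right_action G Y act' \<and>
    tarski_number G Y act' = tarski_number G X act"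
proof -
  interpret F: faithful_right_action G X act by fact
  interpret T: transitive_right_action G X act by fact
  define \<iota> where "\<iota> = to_nat_on X"
  define \<kappa> where "\<kappa> = from_nat_into X"
  define Y where "Y = \<iota> ` X"
  define act' where "act' y g = \<iota> (act (\<kappa> y) g)" for y g
  have \<kappa>\<iota>: "\<kappa> (\<iota> x) = x" if "x \<in> X" for x
    using that assms(1) by (simp add: \<iota>_def \<kappa>_def)
  have \<kappa>X: "\<kappa> y \<in> X" "\<iota> (\<kappa> y) = y" if "y \<in> Y" for y
    using that \<kappa>\<iota> by (auto simp: Y_def)
  have equivariant: "act' (\<iota> x) g = \<iota> (act x g)" if "x \<in> X" for x g
    using that by (simp add: act'_def \<kappa>\<iota>)
  have \<iota>Y: "\<iota> x \<in> Y" if "x \<in> X" for x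
    using that by (simp add: Y_def)
  have Y_action: "right_action G Y act'"
  proof unfold_locales
    show "act' y g \<in> Y" if "y \<in> Y" "g \<in> carrier G" for y g
      using that by (simp add: act'_def \<iota>Y F.act_closed \<kappa>X)
    show "act' y \<one>\<^bsub>G\<^esub> = y" if "y \<in> Y" for y
      using that by (simp add: act'_def F.act_one \<kappa>X)
    show "act' y (g \<otimes>\<^bsub>G\<^esub> h) = act' (act' y g) h"
      if "y \<in> Y" "g \<in> carrier G" "h \<in> carrier G" for y g h
      using that by (simp add: act'_def F.act_mult F.act_closed \<kappa>X \<kappa>\<iota>)
  qed
  interpret Y: right_action G Y act' by (rule Y_action)
  have "faithful_right_action G Y act'"
  proof unfold_locales
    fix g assume g: "g \<in> carrier G" "\<And>y. y \<in> Y \<Longrightarrow> act' y g = y"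
    have "act x g = x" if "x \<in> X" for x
    proof -
      have "\<iota> (act x g) = \<iota> x" using g(2)[OF \<iota>Y[OF that]] equivariant[OF that] by simp
      then show ?thesis using \<kappa>\<iota> F.act_closed that g(1) by metis
    qed
    then show "g = \<one>\<^bsub>G\<^esub>" using F.faithful g(1) by blast
  qed
  moreover have "transitive_right_action G Y act'"
  proof unfold_locales
    show "Y \<noteq> {}" using T.nonempty by (simp add: Y_def)
    fix y z assume "y \<in> Y" "z \<in> Y"
    then obtain g where "g \<in> carrier G" "act (\<kappa> y) g = \<kappa> z"
      using T.transitive \<kappa>X(1) by metis
    then show "\<exists>g\<in>carrier G. act' y g = z"
      using \<kappa>X(2)[OF \<open>z \<in> Y\<close>] by (intro bexI[of _ g]) (simp_all add: act'_def)
  qed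
  moreover have "tarski_number G Y act' = tarski_number G X act"
  proof (rule antisym)
    have "bij_betw \<iota> X Y"
      using assms(1) by (auto simp: \<iota>_def Y_def bij_betw_def)
    then show "tarski_number G Y act' \<le> tarski_number G X act"
      using equivariant by (rule tarski_number_le_of_bijection)
    have "bij_betw \<kappa> Y X"
      using \<kappa>X \<iota>Y \<kappa>\<iota> by (intro bij_betw_byWitness[of _ \<iota>]) auto
    then show "tarski_number G X act \<le> tarski_number G Y act'"
      by (rule tarski_number_le_of_bijection) (simp add: act'_def \<kappa>\<iota> F.act_closed \<kappa>X)
  qed
  ultimately show ?thesis by blast
qed

section \<open>Actions with prescribed Tarski number\<close>

theorem theorem1:
  fixes k :: nat
  assumes "k \<ge> 4"
  shows "\<exists>(F :: nat monoid) (X :: nat set) (act :: nat \<Rightarrow> nat \<Rightarrow> nat).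
           free_group F \<and> finitely_generated_group F \<and>
           faithful_right_action F X act \<and> transitive_right_action F X act \<and>
           tarski_number F X act = enat k"
proof -
  (* k - 3 elements for S', and one each for s and t *)
  obtain F :: "nat monoid" and S where
    F: "group F" "free_basis F S" "finite S" "card S = Suc (Suc (k - 3))"
    using free_group_of_rank_exists by blast
  interpret free_on F S
    using F by (intro free_on.intro free_on_axioms.intro)
  obtain s R where R: "S = insert s R" "s \<notin> R" "card R = Suc (k - 3)"
    using F(4) by (metis card_Suc_eq)
  obtain t S' where S': "R = insert t S'" "t \<notin> S'" "card S' = k - 3"
    using R(3) by (metis card_Suc_eq)
  have basis_split: "S = insert s (insert t S')" "finite S'" "S' \<noteq> {}" "s \<noteq> t" "s \<notin> S'" "t \<notin> S'"
    using F(3) R S' assms by auto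
  obtain X :: "((nat set \<times> nat) \<times> nat set) set" and act where
    X: "countable X" "faithful_right_action F X act" "transitive_right_action F X act" and
    fixed: "\<forall>T. finite T \<and> T \<subseteq> carrier F \<and> card T \<le> card S' \<longrightarrow> (\<exists>x\<in>X. \<forall>g\<in>T. act x g = x)" and
    injections: "\<exists>f. inj_on f (X \<times> UNIV) \<and>
       (\<forall>x\<in>X. f (x, False) \<in> {x, act x s} \<and> f (x, True) \<in> insert x (act x ` S'))"
    using sparse_action_exists[OF _ basis_split] by auto
  interpret transitive_right_action F X act by (rule X(3))
  have "tarski_number F X act = enat (card S' + 3)"
  proof (rule antisym)
    obtain f where f: "inj_on f (X \<times> UNIV)" "\<And>x. x \<in> X \<Longrightarrow> f (x, False) \<in> {x, act x s}"
      "\<And>x. x \<in> X \<Longrightarrow> f (x, True) \<in> insert x (act x ` S')"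
      using injections by blast
    have "s \<in> carrier F" "S' \<subseteq> carrier F"
      using basis_split(1) basis_in_carrier by auto
    then show "tarski_number F X act \<le> enat (card S' + 3)"
      using basis_split(2) f by (rule tarski_number_le)
    show "enat (card S' + 3) \<le> tarski_number F X act"
      using fixed by (intro tarski_number_ge) blast
  qed
  also have "card S' + 3 = k"
    using S'(3) assms by simp
  finally have tarski: "tarski_number F X act = enat k" .
  have "free_group F"
    using F by (auto simp: free_group_def)
  moreover have "finitely_generated_group F"
    using F generate_basis basis_in_carrier by (auto simp: finitely_generated_group_def)
  ultimately show ?thesis
    using countable_action_on_naturals[OF X] tarski by metis
qed

end
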